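(* Let $A$ be a Boolean algebra. There is a Boolean algebra $B$ of the same cardinality as $A$, without uncountable well-ordered chains, such that the Banach space $C(K_B)$ contains an isometric copy of $C(K_A)$.
   Context: For a Boolean algebra $A$, $K_A$ denotes its Stone space, i.e. the compact Hausdorff totally disconnected space such that $A$ is isomorphic to the algebra of all clopen subsets of $K_A$. For a compact Hausdorff space $K$, $C(K)$ is the Banach space of real-valued continuous functions on $K$ with the supremum norm. "$C(K_B)$ contains an isometric copy of $C(K_A)$" means that there is a linear isometry from $C(K_A)$ onto a linear subspace of $C(K_B)$. An uncountable well-ordered chain in a Boolean algebra is an uncountable subset that is well-ordered by the Boolean order. *)

theory Defs
  imports "HOL-Analysis.Analysis" "HOL-Algebra.Lattice" "HOL-Library.Equipollence"
begin

(* The degenerate one-element algebra (bottom = top) is admitted; its Stone space is empty. *)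
locale boolean_alg = bounded_lattice L for L (structure) +
  assumes meet_join_distrib:
      "\<lbrakk>x \<in> carrier L; y \<in> carrier L; z \<in> carrier L\<rbrakk>
        \<Longrightarrow> x \<sqinter> (y \<squnion> z) = (x \<sqinter> y) \<squnion> (x \<sqinter> z)"
    and complement_exists:
      "x \<in> carrier L \<Longrightarrow> \<exists>y\<in>carrier L. x \<sqinter> y = \<bottom> \<and> x \<squnion> y = \<top>"

definition well_ordered_chain :: "('a, 'm) gorder_scheme \<Rightarrow> 'a set \<Rightarrow> bool" where
  "well_ordered_chain L C \<longleftrightarrow>
     C \<subseteq> carrier L \<and> well_order_on C {(x, y). x \<in> C \<and> y \<in> C \<and> x \<sqsubseteq>\<^bsub>L\<^esub> y}"

definition clopens :: "'k topology \<Rightarrow> 'k set set" where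
  "clopens K = {U. openin K U \<and> closedin K U}"

definition totally_disconnected_space :: "'k topology \<Rightarrow> bool" where
  "totally_disconnected_space K \<longleftrightarrow> (\<forall>S. connectedin K S \<longrightarrow> (\<exists>x. S \<subseteq> {x}))"

(* An isomorphism of Boolean algebras onto the clopen algebra of K; preservation of
   complements follows from the four conditions below, complements being unique. *)
definition clopen_iso :: "('a, 'm) gorder_scheme \<Rightarrow> 'k topology \<Rightarrow> ('a \<Rightarrow> 'k set) \<Rightarrow> bool" where
  "clopen_iso L K h \<longleftrightarrow>
     bij_betw h (carrier L) (clopens K) \<and>
     (\<forall>x\<in>carrier L. \<forall>y\<in>carrier L. h (x \<squnion>\<^bsub>L\<^esub> y) = h x \<union> h y) \<and>
     (\<forall>x\<in>carrier L. \<forall>y\<in>carrier L. h (x \<sqinter>\<^bsub>L\<^esub> y) = h x \<inter> h y) \<and>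
     h \<bottom>\<^bsub>L\<^esub> = {} \<and> h \<top>\<^bsub>L\<^esub> = topspace K"

(* The Stone space is unique only up to homeomorphism, hence a predicate. *)
definition stone_space_of :: "('a, 'm) gorder_scheme \<Rightarrow> 'k topology \<Rightarrow> bool" where
  "stone_space_of L K \<longleftrightarrow>
     compact_space K \<and> Hausdorff_space K \<and> totally_disconnected_space K \<and>
     (\<exists>h. clopen_iso L K h)"

(* C(K), with the pointwise vector space operations. Functions in HOL are total, so each
   continuous function on K is represented by its extension by 0 outside the points of K. *)
definition cont_funs :: "'k topology \<Rightarrow> ('k \<Rightarrow> real) set" where
  "cont_funs K = {f. continuous_map K euclideanreal f \<and> (\<forall>x. x \<notin> topspace K \<longrightarrow> f x = 0)}"

(* Inserting 0 matters only when K has no points: C(K) is then the zero space. *)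
definition sup_norm :: "'k topology \<Rightarrow> ('k \<Rightarrow> real) \<Rightarrow> real" where
  "sup_norm K f = Sup (insert 0 ((\<lambda>x. \<bar>f x\<bar>) ` topspace K))"

(* A linear isometry; its range is automatically a linear subspace of C(K'). *)
definition linear_isometry_C :: "'k topology \<Rightarrow> 'l topology \<Rightarrow> (('k \<Rightarrow> real) \<Rightarrow> ('l \<Rightarrow> real)) \<Rightarrow> bool" where
  "linear_isometry_C K K' T \<longleftrightarrow>
     T \<in> cont_funs K \<rightarrow> cont_funs K' \<and>
     (\<forall>f\<in>cont_funs K. \<forall>g\<in>cont_funs K. T (\<lambda>x. f x + g x) = (\<lambda>y. T f y + T g y)) \<and>
     (\<forall>c. \<forall>f\<in>cont_funs K. T (\<lambda>x. c * f x) = (\<lambda>y. c * T f y)) \<and>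
     (\<forall>f\<in>cont_funs K. sup_norm K' (T f) = sup_norm K f)"

definition C_contains_isometric_copy :: "'l topology \<Rightarrow> 'k topology \<Rightarrow> bool" where
  "C_contains_isometric_copy K' K \<longleftrightarrow> (\<exists>T. linear_isometry_C K K' T)"

end

theory Submission
  imports Defs
begin

text \<open>
The obvious way to put a copy of \<open>C(K)\<close> into some \<open>C(K')\<close>, a continuous surjection of
\<open>K'\<close> onto \<open>K\<close>, makes \<open>A\<close> a subalgebra of \<open>B\<close> and preserves its chains. Instead, let
\<open>K'\<close> map onto the unit ball of the dual of \<open>C(K)\<close> with the weak-star topology. Evaluation
is an isometry of \<open>C(K)\<close> into the continuous functions on that ball, so any totally disconnected
compact \<open>K'\<close> mapping onto it will do for the isometry.

A functional in the ball is determined by its values in \<open>[-1, 1]\<close> on the clopen sets of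
\<open>K\<close>, since simple functions are dense in \<open>C(K)\<close>. A point of \<open>K'\<close> is a functional together
with a signed binary expansion of each of these values, the expansions being chosen independently
when a value has two of them. The space \<open>K'\<close> (\<open>coded_space\<close>) is compact and totally
disconnected, and its clopen sets are finite combinations of conditions on single digits; for
infinite \<open>A\<close> there are as many of them as elements of \<open>A\<close>
(\<open>clopens_coded_space_eqpoll\<close>).

There is no uncountable well-ordered chain of clopen sets of \<open>K'\<close>
(\<open>countable_coded_chain\<close>). Thin out such a chain so that its initial segments are
countable and the finite supports of its members form, nearly, a Delta-system with root \<open>R\<close>, and
fix the digits that matter over \<open>R\<close>. Choose a point in all members and a point in none, and join
their functionals by a segment; by convexity the fixed digits can be retained all along it. For each
member \<open>c\<close> there is a last time \<open>\<tau> c\<close> at which some choice of expansions lies in \<open>c\<close>, and at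
that time another choice lies outside \<open>c\<close>. For \<open>c \<subset> d\<close> with supports meeting in \<open>R\<close> the
choices for \<open>c\<close> and for \<open>d\<close> are independent, so the times cannot coincide and
\<open>\<tau> c < \<tau> d\<close> (\<open>switching_times\<close>). Up to countable exceptions \<open>\<tau>\<close> is then a strictly
increasing map from an uncountable well-ordered set to the reals, which is impossible.

Finally \<open>B\<close> is the algebra of clopen sets of \<open>K'\<close>, carried over to the carrier of \<open>A\<close>
along a bijection (\<open>boolean_algebra_with_stone_space\<close>). For finite \<open>A\<close> the space
\<open>K\<close> itself serves as \<open>K'\<close>.
\<close>

section \<open>Uncountable families\<close>

text \<open>A countable set of values approaches the supremum, and if the supremum is attained then one
sublevel set is everything.\<close>

lemma countable_if_countable_real_sublevels:
  fixes t :: "'b \<Rightarrow> real"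
  assumes "\<And>a. a \<in> X \<Longrightarrow> countable {b \<in> X. t b \<le> t a}" and "bdd_above (t ` X)"
  shows "countable X"
proof (cases "X = {} \<or> (\<exists>a\<in>X. t a = Sup (t ` X))")
  case True
  then show ?thesis
  proof
    assume "\<exists>a\<in>X. t a = Sup (t ` X)"
    then obtain a where a: "a \<in> X" "t a = Sup (t ` X)" by blast
    have "X \<subseteq> {b \<in> X. t b \<le> t a}"
      using a(2) assms(2) by (auto intro: cSup_upper)
    then show ?thesis using assms(1)[OF a(1)] countable_subset by blast
  qed simp
next
  case False
  define s where "s = Sup (t ` X)"
  have ne: "t ` X \<noteq> {}" using False by simp
  have lt: "t b < s" if "b \<in> X" for b
    using False that assms(2) unfolding s_def by (metis cSup_upper imageI order_less_le)
  have "\<exists>a\<in>X. s - inverse (Suc n) < t a" for n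
    using less_cSup_iff[OF ne assms(2), of "s - inverse (Suc n)"] unfolding s_def by auto
  then obtain a where a: "\<And>n. a n \<in> X" "\<And>n. s - inverse (Suc n) < t (a n)" by metis
  have "X \<subseteq> (\<Union>n. {b \<in> X. t b \<le> t (a n)})"
  proof
    fix b assume b: "b \<in> X"
    obtain n where "inverse (Suc n) < s - t b"
      using reals_Archimedean[of "s - t b"] lt[OF b] by auto
    then show "b \<in> (\<Union>n. {b \<in> X. t b \<le> t (a n)})"
      using a(2)[of n] b by (auto intro!: exI[of _ n])
  qed
  moreover have "countable (\<Union>n. {b \<in> X. t b \<le> t (a n)})"
    using assms(1) a(1) by auto
  ultimately show ?thesis by (rule countable_subset)
qed

lemma uncountable_fibre:
  assumes "uncountable X"
  obtains n :: nat where "uncountable {x \<in> X. f x = n}"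
proof -
  have "X = (\<Union>n. {x \<in> X. f x = n})" by auto
  then have "\<not> (\<forall>n. countable {x \<in> X. f x = n})"
    using assms countable_UN[of "UNIV :: nat set" "\<lambda>n. {x \<in> X. f x = n}"] by auto
  then show thesis using that by blast
qed

text \<open>This is the part of the Delta-system lemma that is needed below. Among the members of one common
size \<open>n\<close>, let \<open>R\<close> be a largest finite set contained in uncountably many of them; by
maximality every index outside \<open>R\<close> belongs to only countably many of these, so a given
member meets all but countably many of the others exactly in \<open>R\<close>.\<close>

lemma uncountable_root:
  fixes F :: "'b \<Rightarrow> 'i set"
  assumes "uncountable X" and fin: "\<And>x. x \<in> X \<Longrightarrow> finite (F x)"
  obtains Y R where "Y \<subseteq> X" "uncountable Y" "finite R"
    "\<forall>x\<in>Y. countable {y \<in> Y. F x \<inter> F y \<noteq> R}"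
proof -
  obtain n where n: "uncountable {x \<in> X. card (F x) = n}" 
    (is "uncountable ?X")
    by (rule uncountable_fibre[OF assms(1)])
  define P where "P r \<longleftrightarrow> (\<exists>R. finite R \<and> card R = r \<and> uncountable {x \<in> ?X. R \<subseteq> F x})" for r
  have P0: "P 0" unfolding P_def using n by (intro exI[of _ "{}"]) auto
  have bound: "r \<le> n" if "P r" for r
  proof -
    from that obtain R where R: "card R = r" "uncountable {x \<in> ?X. R \<subseteq> F x}"
      unfolding P_def by blast
    then obtain x where "x \<in> ?X" "R \<subseteq> F x"
      by (metis (mono_tags, lifting) countable_empty empty_Collect_eq mem_Collect_eq)
    then show ?thesis using R(1) fin card_mono by fastforce
  qed
  obtain r where r: "P r" "\<And>r'. P r' \<Longrightarrow> r' \<le> r"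
    using GreatestI_nat[of P 0 n, OF P0 bound] Greatest_le_nat[of P _ n, OF _ bound] by metis
  obtain R where R: "finite R" "card R = r" "uncountable {x \<in> ?X. R \<subseteq> F x}"
    using r(1) unfolding P_def by blast
  define Y where "Y = {x \<in> ?X. R \<subseteq> F x}"
  have cnt: "countable {y \<in> Y. i \<in> F y}" if "i \<notin> R" for i
  proof (rule ccontr)
    assume "\<not> ?thesis"
    moreover have "{y \<in> Y. i \<in> F y} = {x \<in> ?X. insert i R \<subseteq> F x}" unfolding Y_def by auto
    ultimately have "P (card (insert i R))" unfolding P_def using R(1) by auto
    then show False using r(2) that R(1,2) by fastforce
  qed
  have "countable {y \<in> Y. F x \<inter> F y \<noteq> R}" if "x \<in> Y" for x
  proof -
    have "{y \<in> Y. F x \<inter> F y \<noteq> R} \<subseteq> (\<Union>i \<in> F x - R. {y \<in> Y. i \<in> F y})"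
      using that unfolding Y_def by blast
    moreover have "countable (F x - R)"
      using that fin unfolding Y_def by (simp add: countable_finite)
    then have "countable (\<Union>i \<in> F x - R. {y \<in> Y. i \<in> F y})"
      by (rule countable_UN) (rule cnt, simp)
    ultimately show ?thesis by (rule countable_subset)
  qed
  then have "\<forall>x\<in>Y. countable {y \<in> Y. F x \<inter> F y \<noteq> R}" by blast
  moreover have "Y \<subseteq> X" unfolding Y_def by auto
  moreover have "uncountable Y" using R(3) unfolding Y_def .
  ultimately show thesis using R(1) by (intro that)
qed

text \<open>A product of finitely many countable sets is countable.\<close>

lemma uncountable_image_of_finite_decomposition:
  assumes "uncountable X" "finite I" "inj_on (\<lambda>x. \<lambda>i\<in>I. f i x) X"
  obtains i where "i \<in> I" "uncountable (f i ` X)"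
proof (rule ccontr)
  assume "\<not> thesis"
  with that have "\<forall>i\<in>I. countable (f i ` X)" by blast
  then have "countable (PiE I (\<lambda>i. f i ` X))" by (intro countable_PiE assms(2)) auto
  moreover have "(\<lambda>x. \<lambda>i\<in>I. f i x) ` X \<subseteq> PiE I (\<lambda>i. f i ` X)" by auto
  ultimately have "countable ((\<lambda>x. \<lambda>i\<in>I. f i x) ` X)" by (rule countable_subset[rotated])
  then show False using assms(1,3) countable_image_inj_on by blast
qed

text \<open>If some initial segment is uncountable, the one below the least such point has the required
property; otherwise the whole set has it.\<close>

lemma well_order_countable_initial_segments:
  assumes wo: "well_order_on C r" and unc: "uncountable C"
  obtains D where "D \<subseteq> C" "uncountable D" "\<forall>x\<in>D. countable {y \<in> D. (y, x) \<in> r}"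
proof (cases "\<exists>x\<in>C. uncountable {y \<in> C. (y, x) \<in> r}")
  case False
  then show thesis using that[of C] unc by blast
next
  case True
  have wf: "wf (r - Id)" and lin: "linear_order_on C r"
    using wo unfolding well_order_on_def by auto
  define Q where "Q = {x \<in> C. uncountable {y \<in> C. (y, x) \<in> r}}"
  obtain x where "x \<in> Q" and "\<And>y. (y, x) \<in> r - Id \<Longrightarrow> y \<notin> Q"
    using wfE_min'[OF wf, of Q] True unfolding Q_def by blast
  then have x: "x \<in> C" "uncountable {y \<in> C. (y, x) \<in> r}"
    and min: "\<And>y. (y, x) \<in> r - Id \<Longrightarrow> y \<in> C \<Longrightarrow> countable {z \<in> C. (z, y) \<in> r}"
    unfolding Q_def by blast+
  define D where "D = {y \<in> C. (y, x) \<in> r} - {x}"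
  have "\<forall>y\<in>D. countable {z \<in> D. (z, y) \<in> r}"
  proof
    fix y assume "y \<in> D"
    then have "countable {z \<in> C. (z, y) \<in> r}" unfolding D_def by (intro min) auto
    then show "countable {z \<in> D. (z, y) \<in> r}"
      by (rule countable_subset[rotated]) (auto simp: D_def)
  qed
  moreover have "uncountable D"
    using x(2) unfolding D_def by (simp add: uncountable_minus_countable)
  moreover have "D \<subseteq> C" unfolding D_def by auto
  ultimately show thesis by (intro that)
qed

section \<open>Simple functions on Boolean spaces\<close>

lemma clopensD: "U \<in> clopens K \<Longrightarrow> openin K U" "U \<in> clopens K \<Longrightarrow> closedin K U"
    "U \<in> clopens K \<Longrightarrow> U \<subseteq> topspace K"
  by (auto simp: clopens_def dest: openin_subset)

lemma clopens_boolean_ops: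
  "U \<in> clopens K \<Longrightarrow> V \<in> clopens K \<Longrightarrow> U \<union> V \<in> clopens K"
  "U \<in> clopens K \<Longrightarrow> V \<in> clopens K \<Longrightarrow> U \<inter> V \<in> clopens K"
  "U \<in> clopens K \<Longrightarrow> V \<in> clopens K \<Longrightarrow> U - V \<in> clopens K"
  "{} \<in> clopens K" "topspace K \<in> clopens K"
  by (auto simp: clopens_def openin_diff closedin_diff)

text \<open>In a compact Hausdorff space quasi-components and connected components coincide.\<close>

lemma quasi_component_singleton:
  assumes "compact_space K" "Hausdorff_space K" "totally_disconnected_space K" "x \<in> topspace K"
  shows "{y. quasi_component_of K x y} = {x}"
proof -
  have "quasi_component_of K x = connected_component_of K x"
    by (rule quasi_eq_connected_component_of) (use assms in blast)
  moreover have "connected_component_of K x y \<longleftrightarrow> y = x" for y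
  proof
    assume "connected_component_of K x y"
    then obtain S where "connectedin K S" "x \<in> S" "y \<in> S"
      unfolding connected_component_of_def by blast
    then show "y = x" using assms(3) unfolding totally_disconnected_space_def by blast
  qed (simp add: assms(4) connected_component_of_refl)
  ultimately show ?thesis by auto
qed

lemma clopen_neighbourhood:
  assumes "compact_space K" "Hausdorff_space K" "totally_disconnected_space K"
    and "openin K W" "x \<in> W"
  obtains U where "U \<in> clopens K" "x \<in> U" "U \<subseteq> W"
proof -
  have x: "x \<in> topspace K" using assms(4,5) openin_subset by blast
  have "{x} \<in> quasi_components_of K"
    using quasi_component_singleton[OF assms(1-3) x] x
    unfolding quasi_components_of_def by blast
  moreover have "compactin K (topspace K - W)"
    using assms(1,4) closedin_compact_space by blast
  ultimately have "separated_between K {x} (topspace K - W)"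
    using assms(5) by (simp add: separated_between_quasi_component_compact)
  then obtain U V where UV: "openin K U" "openin K V" "U \<union> V = topspace K" "disjnt U V"
      "{x} \<subseteq> U" "topspace K - W \<subseteq> V"
    unfolding separated_between_def by blast
  then have "U = topspace K - V" by (auto simp: disjnt_iff)
  then have "U \<in> clopens K" using UV unfolding clopens_def by auto
  then show thesis using that UV by (auto simp: disjnt_iff)
qed

lemma clopens_separate_points:
  assumes "compact_space K" "Hausdorff_space K" "totally_disconnected_space K"
    and "x \<in> topspace K" "y \<in> topspace K" "x \<noteq> y"
  obtains U where "U \<in> clopens K" "x \<in> U" "y \<notin> U"
proof -
  have "openin K (topspace K - {y})"
    using closedin_Hausdorff_singleton[OF assms(2,5)] by (intro openin_diff) auto
  moreover have "x \<in> topspace K - {y}" using assms(4,6) by simp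
  ultimately obtain U where "U \<in> clopens K" "x \<in> U" "U \<subseteq> topspace K - {y}"
    by (rule clopen_neighbourhood[OF assms(1-3)])
  then show thesis using that by blast
qed

lemma indicator_cont_funs:
  assumes "U \<in> clopens K"
  shows "(indicator U :: _ \<Rightarrow> real) \<in> cont_funs K"
proof -
  have "openin K {x \<in> topspace K. (indicator U x :: real) \<in> V}" for V
  proof -
    have "{x \<in> topspace K. (indicator U x :: real) \<in> V} \<in> {{}, U, topspace K - U, topspace K}"
      using clopensD(3)[OF assms]
      by (cases "(1::real) \<in> V"; cases "(0::real) \<in> V") (auto simp: indicator_def of_bool_def)
    moreover have "openin K W" if "W \<in> {{}, U, topspace K - U, topspace K}" for W
      using that clopensD(1,2)[OF assms] by (auto intro: openin_diff)
    ultimately show ?thesis by blast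
  qed
  then show ?thesis
    using clopensD(3)[OF assms] unfolding cont_funs_def continuous_map_def
    by (auto simp: indicator_def)
qed

lemma cont_funs_add: "f \<in> cont_funs K \<Longrightarrow> g \<in> cont_funs K \<Longrightarrow> (\<lambda>x. f x + g x) \<in> cont_funs K"
  unfolding cont_funs_def by (auto intro: continuous_map_add)

lemma cont_funs_scale: "f \<in> cont_funs K \<Longrightarrow> (\<lambda>x. c * f x) \<in> cont_funs K"
  unfolding cont_funs_def by (auto intro: continuous_map_real_mult)

lemma cont_funs_zero: "(\<lambda>x. 0) \<in> cont_funs K"
  unfolding cont_funs_def by auto

lemma abs_le_sup_norm:
  assumes "compact_space K" "f \<in> cont_funs K"
  shows "\<bar>f x\<bar> \<le> sup_norm K f"
proof -
  have "compactin euclideanreal (f ` topspace K)"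
    using assms image_compactin unfolding cont_funs_def compact_space_def by blast
  then have "bounded (f ` topspace K)"
    by (simp add: compact_imp_bounded)
  then obtain B where "\<And>x. x \<in> topspace K \<Longrightarrow> \<bar>f x\<bar> \<le> B"
    by (auto simp: bounded_iff)
  then have b: "bdd_above (insert 0 ((\<lambda>x. \<bar>f x\<bar>) ` topspace K))"
    by (auto intro!: bdd_aboveI[of _ B])
  show ?thesis
  proof (cases "x \<in> topspace K")
    case True
    then show ?thesis unfolding sup_norm_def by (intro cSup_upper b) auto
  next
    case False
    then have "f x = 0" using assms(2) unfolding cont_funs_def by blast
    then show ?thesis unfolding sup_norm_def by (auto intro!: cSup_upper b)
  qed
qed

lemma sup_norm_leI:
  assumes "0 \<le> b" "\<And>x. x \<in> topspace K \<Longrightarrow> \<bar>f x\<bar> \<le> b"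
  shows "sup_norm K f \<le> b"
  unfolding sup_norm_def using assms by (intro cSup_least) auto

inductive_set simple_funs :: "'k topology \<Rightarrow> ('k \<Rightarrow> real) set" for K where
  zero: "(\<lambda>x. 0) \<in> simple_funs K"
| step: "g \<in> simple_funs K \<Longrightarrow> U \<in> clopens K \<Longrightarrow> (\<lambda>x. g x + c * indicator U x) \<in> simple_funs K"

lemma simple_funs_subset_cont_funs: "g \<in> simple_funs K \<Longrightarrow> g \<in> cont_funs K"
proof (induction rule: simple_funs.induct)
  case zero
  show ?case by (rule cont_funs_zero)
next
  case (step g U c)
  show ?case by (rule cont_funs_add[OF step.IH cont_funs_scale[OF indicator_cont_funs[OF step.hyps(2)]]])
qed

text \<open>Finitely many clopen sets on which \<open>f\<close> oscillates by at most \<open>e\<close> cover the space;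
they are made disjoint one at a time, and on each new piece the approximation takes a value of
\<open>f\<close>.\<close>

lemma simple_funs_dense:
  assumes K: "compact_space K" "Hausdorff_space K" "totally_disconnected_space K"
    and f: "f \<in> cont_funs K" and e: "0 < e"
  obtains g where "g \<in> simple_funs K" "\<forall>x\<in>topspace K. \<bar>f x - g x\<bar> \<le> e"
proof -
  have "\<exists>U \<in> clopens K. p \<in> U \<and> (\<forall>x\<in>U. \<bar>f x - f p\<bar> \<le> e)" if "p \<in> topspace K" for p
  proof -
    have "openin K {x \<in> topspace K. f x \<in> ball (f p) e}"
      by (rule openin_continuous_map_preimage[where Y = euclideanreal])
        (use f in \<open>auto simp: cont_funs_def\<close>)
    moreover have "p \<in> {x \<in> topspace K. f x \<in> ball (f p) e}" using that e by simp
    ultimately obtain U where "U \<in> clopens K" "p \<in> U" "U \<subseteq> {x \<in> topspace K. f x \<in> ball (f p) e}"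
      by (rule clopen_neighbourhood[OF K])
    then show ?thesis
      by (intro bexI[of _ U]) (auto simp: dist_real_def abs_minus_commute subset_iff less_imp_le)
  qed
  then have "\<exists>U. \<forall>p\<in>topspace K. U p \<in> clopens K \<and> p \<in> U p \<and> (\<forall>x\<in>U p. \<bar>f x - f p\<bar> \<le> e)"
    by (intro bchoice) blast
  then obtain U where U: "\<And>p. p \<in> topspace K \<Longrightarrow> U p \<in> clopens K" "\<And>p. p \<in> topspace K \<Longrightarrow> p \<in> U p"
      "\<And>p x. p \<in> topspace K \<Longrightarrow> x \<in> U p \<Longrightarrow> \<bar>f x - f p\<bar> \<le> e"
    by blast+
  obtain P where P: "finite P" "P \<subseteq> topspace K" "topspace K \<subseteq> (\<Union>p\<in>P. U p)"
  proof -
    have "openin K W" if "W \<in> U ` topspace K" for W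
      using U(1) clopensD(1) that by blast
    moreover have "topspace K \<subseteq> \<Union> (U ` topspace K)" using U(2) by blast
    ultimately obtain \<F> where "finite \<F>" "\<F> \<subseteq> U ` topspace K" "topspace K \<subseteq> \<Union>\<F>"
      using compactinD[of K "topspace K"] K(1) unfolding compact_space_def by metis
    moreover then obtain P where "finite P" "P \<subseteq> topspace K" "\<F> = U ` P"
      by (meson finite_subset_image)
    ultimately show thesis using that by blast
  qed
  have "\<exists>g \<in> simple_funs K. (\<Union>p\<in>P. U p) \<in> clopens K \<and>
      (\<forall>x\<in>(\<Union>p\<in>P. U p). \<bar>f x - g x\<bar> \<le> e) \<and> (\<forall>x. x \<notin> (\<Union>p\<in>P. U p) \<longrightarrow> g x = 0)"
    using P(1,2)
  proof (induction P rule: finite_induct)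
    case empty
    show ?case by (intro bexI[OF _ simple_funs.zero]) (auto simp: clopens_boolean_ops)
  next
    case (insert p P)
    then obtain g where g: "g \<in> simple_funs K" "(\<Union>p\<in>P. U p) \<in> clopens K"
      "\<forall>x\<in>(\<Union>p\<in>P. U p). \<bar>f x - g x\<bar> \<le> e" "\<forall>x. x \<notin> (\<Union>p\<in>P. U p) \<longrightarrow> g x = 0" by auto
    have p: "p \<in> topspace K" using insert by auto
    define V where "V = U p - (\<Union>p\<in>P. U p)"
    have V: "V \<in> clopens K" unfolding V_def using g(2) U(1)[OF p] by (rule clopens_boolean_ops(3)[rotated])
    show ?case
    proof (intro bexI[OF _ simple_funs.step[OF g(1) V, of "f p"]] conjI ballI allI impI)
      show "(\<Union>p\<in>insert p P. U p) \<in> clopens K"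
        using clopens_boolean_ops(1)[OF U(1)[OF p] g(2)] by simp
    next
      fix x assume "x \<in> (\<Union>p\<in>insert p P. U p)"
      then show "\<bar>f x - (g x + f p * indicator V x)\<bar> \<le> e"
        using g(3,4) U(3)[OF p, of x] unfolding V_def by (cases "x \<in> (\<Union>p\<in>P. U p)") auto
    next
      fix x assume "x \<notin> (\<Union>p\<in>insert p P. U p)"
      then show "g x + f p * indicator V x = 0" using g(4) unfolding V_def by auto
    qed
  qed
  then show thesis using that P(3) by blast
qed

section \<open>The dual ball\<close>

text \<open>The closed unit ball of the dual of \<open>C(K)\<close>. Extensionality makes each functional a point
of the product of copies of the reals indexed by \<open>C(K)\<close>, whose topology is then the weak-star
topology on the ball.\<close>

definition dual_ball :: "'k topology \<Rightarrow> (('k \<Rightarrow> real) \<Rightarrow> real) set" where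
  "dual_ball K = {\<Lambda> \<in> extensional (cont_funs K).
     (\<forall>f\<in>cont_funs K. \<forall>g\<in>cont_funs K. \<Lambda> (\<lambda>x. f x + g x) = \<Lambda> f + \<Lambda> g) \<and>
     (\<forall>c. \<forall>f\<in>cont_funs K. \<Lambda> (\<lambda>x. c * f x) = c * \<Lambda> f) \<and>
     (\<forall>f\<in>cont_funs K. \<bar>\<Lambda> f\<bar> \<le> sup_norm K f)}"

lemma dual_ballD:
  assumes "\<Lambda> \<in> dual_ball K" "f \<in> cont_funs K"
  shows "g \<in> cont_funs K \<Longrightarrow> \<Lambda> (\<lambda>x. f x + g x) = \<Lambda> f + \<Lambda> g"
    and "\<Lambda> (\<lambda>x. c * f x) = c * \<Lambda> f" and "\<bar>\<Lambda> f\<bar> \<le> sup_norm K f"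
  using assms unfolding dual_ball_def by blast+

lemma dual_ball_zero: "\<Lambda> \<in> dual_ball K \<Longrightarrow> \<Lambda> (\<lambda>x. 0) = 0"
  using dual_ballD(2)[of \<Lambda> K "\<lambda>x. 0" 0] by (simp add: cont_funs_zero)

text \<open>Since simple functions are dense, a bounded functional is a finitely additive measure on the
clopen sets: it is determined by one real number for each of them. This is what keeps the
number of code digits below as small as the number of clopen sets, although \<open>C(K)\<close> itself may
be larger.\<close>

lemma dual_ball_eqI:
  assumes K: "compact_space K" "Hausdorff_space K" "totally_disconnected_space K"
    and L: "\<Lambda> \<in> dual_ball K" "\<Lambda>' \<in> dual_ball K"
    and eq: "\<And>U. U \<in> clopens K \<Longrightarrow> \<Lambda> (indicator U) = \<Lambda>' (indicator U)"
  shows "\<Lambda> = \<Lambda>'"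
proof (rule extensionalityI)
  show "\<Lambda> \<in> extensional (cont_funs K)" "\<Lambda>' \<in> extensional (cont_funs K)"
    using L unfolding dual_ball_def by auto
  fix f assume f: "f \<in> cont_funs K"
  have simple: "\<Lambda> g = \<Lambda>' g" if "g \<in> simple_funs K" for g
    using that
  proof induction
    case (step g U c)
    show ?case
      using dual_ballD(1)[OF L(1) simple_funs_subset_cont_funs[OF step(1)] cont_funs_scale[OF indicator_cont_funs[OF step(2)]]]
        dual_ballD(1)[OF L(2) simple_funs_subset_cont_funs[OF step(1)] cont_funs_scale[OF indicator_cont_funs[OF step(2)]]]
        dual_ballD(2)[OF L(1) indicator_cont_funs[OF step(2)]]
        dual_ballD(2)[OF L(2) indicator_cont_funs[OF step(2)]] step eq by simp
  qed (use L dual_ball_zero in metis)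
  have "\<bar>\<Lambda> f - \<Lambda>' f\<bar> \<le> 2 * e" if e: "0 < e" for e
  proof -
    obtain g where g: "g \<in> simple_funs K" "\<forall>x\<in>topspace K. \<bar>f x - g x\<bar> \<le> e"
      using K f e by (rule simple_funs_dense)
    have gc: "g \<in> cont_funs K" using g(1) by (rule simple_funs_subset_cont_funs)
    have h: "(\<lambda>x. f x + (-1) * g x) \<in> cont_funs K" by (intro cont_funs_add f cont_funs_scale gc)
    have n: "sup_norm K (\<lambda>x. f x + (-1) * g x) \<le> e"
      using g(2) e by (intro sup_norm_leI) auto
    have "\<bar>M f - M g\<bar> \<le> e" if "M \<in> dual_ball K" for M
      using dual_ballD(1)[OF that f cont_funs_scale[OF gc, of "-1"]] dual_ballD(2)[OF that gc, of "-1"]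
        dual_ballD(3)[OF that h] n by simp
    from this[OF L(1)] this[OF L(2)] simple[OF g(1)] show ?thesis by linarith
  qed
  from this[of "\<bar>\<Lambda> f - \<Lambda>' f\<bar> / 4"] show "\<Lambda> f = \<Lambda>' f" by (cases "\<Lambda> f = \<Lambda>' f") auto
qed

lemma dual_ball_convex:
  assumes L: "\<Lambda> \<in> dual_ball K" "\<Lambda>' \<in> dual_ball K" and t: "0 \<le> t" "t \<le> 1"
  shows "(\<lambda>f\<in>cont_funs K. (1 - t) * \<Lambda> f + t * \<Lambda>' f) \<in> dual_ball K"
proof -
  have "\<bar>(1 - t) * \<Lambda> f + t * \<Lambda>' f\<bar> \<le> sup_norm K f" if "f \<in> cont_funs K" for f
  proof -
    have "\<bar>(1 - t) * \<Lambda> f + t * \<Lambda>' f\<bar> \<le> (1 - t) * \<bar>\<Lambda> f\<bar> + t * \<bar>\<Lambda>' f\<bar>"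
      using t by (intro order.trans[OF abs_triangle_ineq]) (simp add: abs_mult)
    also have "\<dots> \<le> (1 - t) * sup_norm K f + t * sup_norm K f"
      using t L that by (intro add_mono mult_left_mono dual_ballD(3)) auto
    finally show ?thesis by (simp add: algebra_simps)
  qed
  moreover have "(1 - t) * \<Lambda> (\<lambda>x. f x + g x) + t * \<Lambda>' (\<lambda>x. f x + g x)
      = ((1 - t) * \<Lambda> f + t * \<Lambda>' f) + ((1 - t) * \<Lambda> g + t * \<Lambda>' g)"
    if "f \<in> cont_funs K" "g \<in> cont_funs K" for f g
    unfolding dual_ballD(1)[OF L(1) that] dual_ballD(1)[OF L(2) that] by (simp add: algebra_simps)
  moreover have "(1 - t) * \<Lambda> (\<lambda>x. c * f x) + t * \<Lambda>' (\<lambda>x. c * f x)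
      = c * ((1 - t) * \<Lambda> f + t * \<Lambda>' f)" if "f \<in> cont_funs K" for f c
    unfolding dual_ballD(2)[OF L(1) that] dual_ballD(2)[OF L(2) that] by (simp add: algebra_simps)
  ultimately show ?thesis
    unfolding dual_ball_def by (simp add: cont_funs_add cont_funs_scale)
qed

lemma point_evaluation_in_dual_ball:
  assumes "compact_space K"
  shows "(\<lambda>f\<in>cont_funs K. f x) \<in> dual_ball K"
  unfolding dual_ball_def by (simp add: cont_funs_add cont_funs_scale abs_le_sup_norm[OF assms])

section \<open>Signed binary expansions\<close>

definition signed_sum :: "(nat \<Rightarrow> bool) \<Rightarrow> nat \<Rightarrow> real" where
  "signed_sum s N = (\<Sum>n<N. (if s n then 1 else -1) / 2 ^ Suc n)"

text \<open>\<open>sign_code s w\<close> says that \<open>w\<close> is the sum of the series with terms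
\<open>\<plusminus> 1 / 2 ^ (n + 1)\<close>. It is phrased through bounds on the partial sums because each bound is a
closed condition on finitely many digits.\<close>

definition sign_code :: "(nat \<Rightarrow> bool) \<Rightarrow> real \<Rightarrow> bool" where
  "sign_code s w \<longleftrightarrow> (\<forall>N. \<bar>w - signed_sum s N\<bar> \<le> 1 / 2 ^ N)"

lemma signed_sum_Suc: "signed_sum s (Suc N) = signed_sum s N + (if s N then 1 else -1) / 2 ^ Suc N"
  by (simp add: signed_sum_def)

lemma signed_sum_cong: "(\<And>n. n < N \<Longrightarrow> s n = s' n) \<Longrightarrow> signed_sum s N = signed_sum s' N"
  unfolding signed_sum_def by (intro sum.cong) auto

text \<open>The next digit changes the partial sum by at most \<open>1 / 2 ^ (n + 1)\<close>, so a bound on a later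
remainder gives the bounds on all earlier ones.\<close>

lemma remainder_bound_antimono:
  assumes "\<bar>w - signed_sum s (n + k)\<bar> \<le> 1 / 2 ^ (n + k)"
  shows "\<bar>w - signed_sum s n\<bar> \<le> 1 / 2 ^ n"
  using assms
proof (induction k)
  case (Suc k)
  have "\<bar>v\<bar> \<le> d + \<bar>v - (if b then 1 else -1) * d\<bar>" if "0 \<le> d" for v d :: real and b
    using that by (cases b) auto
  from this[of "1 / 2 ^ Suc (n + k)" "w - signed_sum s (n + k)" "s (n + k)"]
  have "\<bar>w - signed_sum s (n + k)\<bar> \<le> 1 / 2 ^ Suc (n + k) + \<bar>w - signed_sum s (Suc (n + k))\<bar>"
    unfolding signed_sum_Suc by (simp add: diff_diff_eq)
  also have "\<dots> \<le> 1 / 2 ^ (n + k)" using Suc.prems by simp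
  finally show ?case by (rule Suc.IH)
qed simp

text \<open>The numbers that have a code with a given prefix form the whole closed interval allowed by that
prefix: after the prefix, the digits are chosen greedily according to the sign of the remainder.\<close>

lemma sign_code_extending_prefix:
  assumes "\<bar>w - signed_sum s N\<bar> \<le> 1 / 2 ^ N"
  shows "\<exists>s'. (\<forall>n<N. s' n = s n) \<and> sign_code s' w"
proof -
  define b where "b n r \<longleftrightarrow> (if n < N then s n else 0 \<le> r)" for n and r :: real
  \<comment> \<open>\<open>r n\<close> is the remainder after \<open>n\<close> digits, and \<open>s'\<close> its sequence of greedy digits.\<close>
  define r where "r = rec_nat w (\<lambda>n r. r - (if b n r then 1 else -1) / 2 ^ Suc n)"
  define s' where "s' n \<longleftrightarrow> b n (r n)" for n
  have r: "r n = w - signed_sum s' n" for n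
    by (induction n) (simp_all add: r_def s'_def signed_sum_Suc, simp add: signed_sum_def)
  have agree: "s' n = s n" if "n < N" for n using that by (simp add: s'_def b_def)
  have late: "\<bar>r (N + k)\<bar> \<le> 1 / 2 ^ (N + k)" for k
  proof (induction k)
    case 0
    then show ?case using assms signed_sum_cong[of N s' s] agree by (simp add: r)
  next
    case (Suc k)
    have "r (N + Suc k) = r (N + k) - (if 0 \<le> r (N + k) then 1 else -1) / 2 ^ Suc (N + k)"
      by (simp add: r_def b_def)
    moreover have "(1::real) / 2 ^ (N + Suc k) = 1 / 2 ^ (N + k) / 2" by simp
    ultimately show ?case using Suc by (auto simp: abs_le_iff split: if_splits)
  qed
  have "\<bar>w - signed_sum s' n\<bar> \<le> 1 / 2 ^ n" for n
    by (rule remainder_bound_antimono[of _ _ _ N]) (use late[of n] in \<open>simp add: r add.commute\<close>)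
  then show ?thesis using agree unfolding sign_code_def by blast
qed

text \<open>The intervals of the preceding lemma are convex, so a prefix shared by the codes of two numbers
is available for every number between them.\<close>

lemma sign_code_convex:
  assumes "sign_code s w" "sign_code s' w'" "\<And>n. n < N \<Longrightarrow> s n = s' n" "0 \<le> t" "t \<le> 1"
  shows "\<bar>(1 - t) * w + t * w' - signed_sum s N\<bar> \<le> 1 / 2 ^ N"
proof -
  have "signed_sum s' N = signed_sum s N" using assms(3) by (intro signed_sum_cong) auto
  then have "(1 - t) * w + t * w' - signed_sum s N
      = (1 - t) * (w - signed_sum s N) + t * (w' - signed_sum s' N)"
    by (simp add: algebra_simps)
  also have "\<bar>\<dots>\<bar> \<le> (1 - t) * \<bar>w - signed_sum s N\<bar> + t * \<bar>w' - signed_sum s' N\<bar>"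
    using assms(4,5) by (intro order.trans[OF abs_triangle_ineq]) (simp add: abs_mult)
  also have "\<dots> \<le> (1 - t) * (1 / 2 ^ N) + t * (1 / 2 ^ N)"
    using assms unfolding sign_code_def by (intro add_mono mult_left_mono) auto
  also have "\<dots> = 1 / 2 ^ N" by (simp add: field_simps)
  finally show ?thesis .
qed

lemma sign_code_unique:
  assumes "sign_code s w" "sign_code s w'"
  shows "w = w'"
proof (rule ccontr)
  assume "w \<noteq> w'"
  then obtain N where N: "(1/2) ^ N < \<bar>w - w'\<bar> / 2"
    using real_arch_pow_inv[of "\<bar>w - w'\<bar> / 2" "1/2"] by auto
  have "\<bar>w - signed_sum s N\<bar> \<le> 1 / 2 ^ N" "\<bar>w' - signed_sum s N\<bar> \<le> 1 / 2 ^ N"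
    using assms unfolding sign_code_def by auto
  then have "\<bar>w - w'\<bar> \<le> 2 * (1/2) ^ N" by (simp add: power_one_over)
  then show False using N by simp
qed

text \<open>The number 1 is an end point of the interval and has only one code, in contrast to interior
dyadic numbers such as 0.\<close>

lemma sign_code_one: "sign_code s 1 \<Longrightarrow> s 0"
  unfolding sign_code_def by (drule spec[of _ 1]) (auto simp: signed_sum_def split: if_splits)

section \<open>The coded dual ball\<close>

definition code_index :: "'k topology \<Rightarrow> ('k set \<times> nat) set" where
  "code_index K = clopens K \<times> UNIV"

definition code_topology :: "'k topology \<Rightarrow> ('k set \<times> nat \<Rightarrow> bool) topology" where
  "code_topology K = product_topology (\<lambda>_. discrete_topology UNIV) (code_index K)"

definition functional_topology :: "'k topology \<Rightarrow> (('k \<Rightarrow> real) \<Rightarrow> real) topology" where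
  "functional_topology K = product_topology (\<lambda>_. euclideanreal) (cont_funs K)"

text \<open>The graph of a coding of the dual ball: a functional \<open>\<Lambda>\<close> is paired with a choice, made
independently for each clopen set \<open>U\<close>, of a code of the number \<open>\<Lambda>\<close> assigns to \<open>U\<close>.
At functionals taking dyadic values several choices are possible, and this freedom is what
destroys long chains. The second component is determined by the first one; keeping it makes
evaluation at a function of \<open>C(K)\<close> visibly continuous.\<close>

definition coded_ball :: "'k topology \<Rightarrow> (('k set \<times> nat \<Rightarrow> bool) \<times> (('k \<Rightarrow> real) \<Rightarrow> real)) set" where
  "coded_ball K = {(z, \<Lambda>). z \<in> extensional (code_index K) \<and> \<Lambda> \<in> dual_ball K \<and>
     (\<forall>U\<in>clopens K. sign_code (\<lambda>n. z (U, n)) (\<Lambda> (indicator U)))}"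

definition coded_space :: "'k topology \<Rightarrow> (('k set \<times> nat \<Rightarrow> bool) \<times> (('k \<Rightarrow> real) \<Rightarrow> real)) topology" where
  "coded_space K = subtopology (prod_topology (code_topology K) (functional_topology K)) (coded_ball K)"

lemma topspace_code_topology: "topspace (code_topology K) = extensional (code_index K)"
  by (auto simp: code_topology_def PiE_def)

lemma topspace_functional_topology: "topspace (functional_topology K) = extensional (cont_funs K)"
  by (auto simp: functional_topology_def PiE_def)

lemma coded_ball_subset:
  "coded_ball K \<subseteq> extensional (code_index K) \<times> extensional (cont_funs K)"
  by (auto simp: coded_ball_def dual_ball_def)

lemma coded_ball_extensional: "y \<in> coded_ball K \<Longrightarrow> fst y \<in> extensional (code_index K)"
  by (auto simp: coded_ball_def)

lemma topspace_coded_space: "topspace (coded_space K) = coded_ball K"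
  unfolding coded_space_def using coded_ball_subset[of K]
  by (auto simp: topspace_code_topology topspace_functional_topology)

text \<open>Codes for different clopen sets do not constrain each other, so prefixes can be prescribed
simultaneously for all of them.\<close>

lemma dual_ball_has_codes:
  assumes M: "\<Lambda> \<in> dual_ball K"
    and prefix: "\<And>U. U \<in> clopens K \<Longrightarrow> \<bar>\<Lambda> (indicator U) - signed_sum (\<sigma> U) (N U)\<bar> \<le> 1 / 2 ^ N U"
  shows "\<exists>z. (z, \<Lambda>) \<in> coded_ball K \<and> (\<forall>U\<in>clopens K. \<forall>n<N U. z (U, n) = \<sigma> U n)"
proof -
  have "\<forall>U\<in>clopens K. \<exists>s. (\<forall>n<N U. s n = \<sigma> U n) \<and> sign_code s (\<Lambda> (indicator U))"
    using sign_code_extending_prefix[OF prefix] by blast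
  from bchoice[OF this] obtain s
    where s: "\<forall>U\<in>clopens K. (\<forall>n<N U. s U n = \<sigma> U n) \<and> sign_code (s U) (\<Lambda> (indicator U))"
    by (rule exE)
  define z where "z = (\<lambda>p\<in>code_index K. s (fst p) (snd p))"
  have z: "z (U, n) = s U n" if "U \<in> clopens K" for U n
    using that by (simp add: z_def code_index_def)
  have "z \<in> extensional (code_index K)" by (simp add: z_def)
  then have "(z, \<Lambda>) \<in> coded_ball K" using M s by (simp add: coded_ball_def z)
  moreover have "\<forall>U\<in>clopens K. \<forall>n<N U. z (U, n) = \<sigma> U n" using s by (simp add: z)
  ultimately show ?thesis by blast
qed

lemma continuous_map_code_coordinate:
  assumes "p \<in> code_index K"
  shows "continuous_map (prod_topology (code_topology K) (functional_topology K))
    (discrete_topology UNIV) (\<lambda>y. fst y p)"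
proof -
  have "continuous_map (code_topology K) (discrete_topology UNIV) (\<lambda>z. z p)"
    unfolding code_topology_def by (rule continuous_map_product_projection[OF assms])
  from continuous_map_compose[OF continuous_map_fst this] show ?thesis by (simp add: o_def)
qed

lemma continuous_map_functional_coordinate:
  assumes "f \<in> cont_funs K"
  shows "continuous_map (prod_topology (code_topology K) (functional_topology K))
    euclideanreal (\<lambda>y. snd y f)"
proof -
  have "continuous_map (functional_topology K) euclideanreal (\<lambda>L. L f)"
    unfolding functional_topology_def by (rule continuous_map_product_projection[OF assms])
  from continuous_map_compose[OF continuous_map_snd this] show ?thesis by (simp add: o_def)
qed

lemma closedin_Collect_conj:
  assumes "closedin X {y \<in> topspace X. P y}" "closedin X {y \<in> topspace X. Q y}"
  shows "closedin X {y \<in> topspace X. P y \<and> Q y}"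
proof -
  have "{y \<in> topspace X. P y \<and> Q y} = {y \<in> topspace X. P y} \<inter> {y \<in> topspace X. Q y}" by blast
  then show ?thesis using closedin_Int[OF assms] by simp
qed

lemma closedin_Collect_ball:
  assumes "\<And>i. i \<in> I \<Longrightarrow> closedin X {y \<in> topspace X. P i y}"
  shows "closedin X {y \<in> topspace X. \<forall>i\<in>I. P i y}"
proof -
  have "closedin X (\<Inter> (insert (topspace X) ((\<lambda>i. {y \<in> topspace X. P i y}) ` I)))"
    using assms by (intro closedin_Inter) auto
  moreover have "\<Inter> (insert (topspace X) ((\<lambda>i. {y \<in> topspace X. P i y}) ` I))
      = {y \<in> topspace X. \<forall>i\<in>I. P i y}" by blast
  ultimately show ?thesis by simp
qed

text \<open>Linearity, the norm bounds and the coding conditions each involve finitely many coordinates and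
are closed.\<close>

lemma closedin_coded_ball:
  "closedin (prod_topology (code_topology K) (functional_topology K)) (coded_ball K)"
proof -
  let ?P = "prod_topology (code_topology K) (functional_topology K)"
  have coord: "continuous_map ?P euclideanreal (\<lambda>y. snd y f)" if "f \<in> cont_funs K" for f
    by (rule continuous_map_functional_coordinate[OF that])
  have eq: "closedin ?P {y \<in> topspace ?P. h y = 0}" if "continuous_map ?P euclideanreal h" for h
    using closedin_continuous_map_preimage[OF that, of "{0}"] by simp
  have le: "closedin ?P {y \<in> topspace ?P. \<bar>h y\<bar> \<le> b}" if "continuous_map ?P euclideanreal h" for h b
    using closedin_continuous_map_preimage[OF that, of "{-b..b}"] by (simp add: abs_le_iff minus_le_iff conj_commute)
  have digits: "continuous_map ?P euclideanreal (\<lambda>y. signed_sum (\<lambda>n. fst y (U, n)) N)"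
    if "U \<in> clopens K" for U N
  proof -
    have "continuous_map ?P euclideanreal (\<lambda>y. (if fst y (U, n) then 1 else -1) / 2 ^ Suc n)" for n
    proof -
      have "(U, n) \<in> code_index K" using that by (simp add: code_index_def)
      moreover have "continuous_map (discrete_topology UNIV) euclideanreal
          (\<lambda>b. (if b then 1 else -1) / 2 ^ Suc n :: real)" by simp
      ultimately have "continuous_map ?P euclideanreal
          ((\<lambda>b. (if b then 1 else -1) / 2 ^ Suc n) \<circ> (\<lambda>y. fst y (U, n)))"
        by (intro continuous_map_compose[OF continuous_map_code_coordinate])
      then show ?thesis by (simp add: o_def)
    qed
    then show ?thesis unfolding signed_sum_def by (intro continuous_map_sum) auto
  qed
  have "closedin ?P {y \<in> topspace ?P.
      (\<forall>f\<in>cont_funs K. \<forall>g\<in>cont_funs K. snd y (\<lambda>x. f x + g x) - (snd y f + snd y g) = 0) \<and>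
      (\<forall>c\<in>UNIV. \<forall>f\<in>cont_funs K. snd y (\<lambda>x. c * f x) - c * snd y f = 0) \<and>
      (\<forall>f\<in>cont_funs K. \<bar>snd y f\<bar> \<le> sup_norm K f) \<and>
      (\<forall>U\<in>clopens K. \<forall>N\<in>UNIV. \<bar>snd y (indicator U) - signed_sum (\<lambda>n. fst y (U, n)) N\<bar> \<le> 1 / 2 ^ N)}"
    (is "closedin ?P ?C")
    by (intro closedin_Collect_conj closedin_Collect_ball eq le continuous_map_diff
        continuous_map_add continuous_map_real_mult_left coord digits
        cont_funs_add cont_funs_scale indicator_cont_funs)
  moreover have "?C = coded_ball K"
    using coded_ball_subset[of K] unfolding coded_ball_def dual_ball_def sign_code_def
    by (auto simp: topspace_code_topology topspace_functional_topology)
  ultimately show ?thesis by simp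
qed

text \<open>Alaoglu's theorem for the coded ball: by Tychonoff it is a closed subset of a compact product.\<close>

lemma compact_coded_space:
  "compact_space (coded_space K)"
proof -
  let ?B = "PiE (cont_funs K) (\<lambda>f. {- sup_norm K f..sup_norm K f})"
  have "compactin (functional_topology K) ?B"
    unfolding functional_topology_def by (simp add: compactin_PiE)
  moreover have "compactin (code_topology K) (extensional (code_index K))"
    unfolding topspace_code_topology[symmetric] compact_space_def[symmetric] code_topology_def
    by (simp add: compact_space_product_topology compact_space_discrete_topology)
  ultimately have "compactin (prod_topology (code_topology K) (functional_topology K))
      (extensional (code_index K) \<times> ?B)"
    by (simp add: compactin_Times)
  moreover have "coded_ball K \<subseteq> extensional (code_index K) \<times> ?B"
    by (auto simp: coded_ball_def dual_ball_def PiE_def Pi_def abs_le_iff minus_le_iff)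
  ultimately have "compactin (prod_topology (code_topology K) (functional_topology K)) (coded_ball K)"
    using closedin_coded_ball closed_compactin by blast
  then show ?thesis by (simp add: coded_space_def compact_space_subtopology)
qed

lemma Hausdorff_code_topology: "Hausdorff_space (code_topology K)"
  and Hausdorff_functional_topology: "Hausdorff_space (functional_topology K)"
  by (simp_all add: code_topology_def functional_topology_def Hausdorff_space_product_topology)

lemma Hausdorff_coded_space: "Hausdorff_space (coded_space K)"
  unfolding coded_space_def
  by (intro Hausdorff_space_subtopology)
    (simp add: Hausdorff_space_prod_topology Hausdorff_code_topology Hausdorff_functional_topology)

lemma continuous_map_fst_coded_space: "continuous_map (coded_space K) (code_topology K) fst"
  and continuous_map_snd_coded_space: "continuous_map (coded_space K) (functional_topology K) snd"
  unfolding coded_space_def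
  by (rule continuous_map_from_subtopology[OF continuous_map_fst])
    (rule continuous_map_from_subtopology[OF continuous_map_snd])

text \<open>A code determines the values of the functional on clopen sets, and these determine the
functional.\<close>

lemma inj_on_fst_coded_ball:
  assumes "compact_space K" "Hausdorff_space K" "totally_disconnected_space K"
  shows "inj_on fst (coded_ball K)"
proof (rule inj_onI, clarsimp)
  fix z \<Lambda> \<Lambda>' assume "(z, \<Lambda>) \<in> coded_ball K" "(z, \<Lambda>') \<in> coded_ball K"
  then show "\<Lambda> = \<Lambda>'"
    unfolding coded_ball_def
    by (intro dual_ball_eqI[OF assms]) (auto intro: sign_code_unique)
qed

lemma totally_disconnected_coded_space:
  assumes "compact_space K" "Hausdorff_space K" "totally_disconnected_space K"
  shows "totally_disconnected_space (coded_space K)"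
  unfolding totally_disconnected_space_def
proof (intro allI impI)
  fix S assume S: "connectedin (coded_space K) S"
  have sub: "S \<subseteq> coded_ball K" using S connectedin_subset_topspace topspace_coded_space by metis
  have "fst y = fst y'" if y: "y \<in> S" "y' \<in> S" for y y'
  proof (rule extensionalityI)
    show "fst y \<in> extensional (code_index K)" "fst y' \<in> extensional (code_index K)"
      using y sub coded_ball_subset by fastforce+
    fix p assume p: "p \<in> code_index K"
    have "continuous_map (coded_space K) (discrete_topology UNIV) (\<lambda>y. fst y p)"
      unfolding coded_space_def
      by (rule continuous_map_from_subtopology[OF continuous_map_code_coordinate[OF p]])
    then have "connectedin (discrete_topology UNIV) ((\<lambda>y. fst y p) ` S)"
      using S connectedin_continuous_map_image by blast
    then obtain b where "(\<lambda>y. fst y p) ` S \<subseteq> {b}"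
      by (auto simp: connectedin_discrete_topology)
    then show "fst y p = fst y' p" using y by blast
  qed
  then have "y = y'" if "y \<in> S" "y' \<in> S" for y y'
    using inj_on_fst_coded_ball[OF assms] that sub by (meson inj_onD subsetD)
  then show "\<exists>x. S \<subseteq> {x}" by blast
qed

definition cylinder :: "'k topology \<Rightarrow> (('k set \<times> nat) \<times> bool) list \<Rightarrow> _ set" where
  "cylinder K l = {y \<in> coded_ball K. \<forall>(p, b)\<in>set l. fst y p = b}"

lemma openin_cylinder:
  assumes "set l \<subseteq> code_index K \<times> UNIV"
  shows "openin (coded_space K) (cylinder K l)"
  using assms
proof (induction l)
  case Nil
  then show ?case using openin_topspace[of "coded_space K"] by (simp add: cylinder_def topspace_coded_space)
next
  case (Cons q l)
  obtain p b where q: "q = (p, b)" by (cases q)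
  have p: "p \<in> code_index K" using Cons(2) q by simp
  have "continuous_map (coded_space K) (discrete_topology UNIV) (\<lambda>y. fst y p)"
    unfolding coded_space_def
    by (rule continuous_map_from_subtopology[OF continuous_map_code_coordinate[OF p]])
  then have "openin (coded_space K) {y \<in> topspace (coded_space K). fst y p \<in> {b}}"
    by (rule openin_continuous_map_preimage) simp
  moreover have "cylinder K (q # l) = {y \<in> topspace (coded_space K). fst y p \<in> {b}} \<inter> cylinder K l"
    unfolding cylinder_def q topspace_coded_space by auto
  ultimately show ?case using Cons by auto
qed

text \<open>The projection to the codes is an embedding, being injective and continuous on a compact space;
so the basic open sets of the product of discrete spaces give a base.\<close>

lemma openin_coded_space_contains_cylinder:
  assumes K: "compact_space K" "Hausdorff_space K" "totally_disconnected_space K"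
    and U: "openin (coded_space K) U" "y \<in> U"
  obtains l where "set l \<subseteq> code_index K \<times> UNIV" "y \<in> cylinder K l" "cylinder K l \<subseteq> U"
proof -
  have "embedding_map (coded_space K) (code_topology K) fst"
    by (rule continuous_imp_embedding_map[OF continuous_map_fst_coded_space compact_coded_space
          Hausdorff_code_topology])
      (simp add: topspace_coded_space inj_on_fst_coded_ball[OF K])
  then have "open_map (coded_space K) (subtopology (code_topology K) (fst ` topspace (coded_space K))) fst"
    unfolding embedding_map_def by (rule homeomorphic_imp_open_map)
  then have "openin (subtopology (code_topology K) (fst ` coded_ball K)) (fst ` U)"
    using U(1) unfolding open_map_def topspace_coded_space by simp
  then obtain V where V: "openin (code_topology K) V" "fst ` U = V \<inter> fst ` coded_ball K"
    unfolding openin_subtopology by auto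
  have UB: "U \<subseteq> coded_ball K" using openin_subset[OF U(1)] topspace_coded_space by metis
  have "fst y \<in> V" using V(2) U(2) by blast
  have "\<forall>x\<in>V. \<exists>X. finite {i \<in> code_index K. X i \<noteq> topspace (discrete_topology (UNIV :: bool set))} \<and>
      (\<forall>i\<in>code_index K. openin (discrete_topology UNIV) (X i)) \<and>
      x \<in> PiE (code_index K) X \<and> PiE (code_index K) X \<subseteq> V"
    by (rule openin_product_topology_alt[THEN iffD1]) (use V(1) in \<open>simp only: code_topology_def\<close>)
  from bspec[OF this \<open>fst y \<in> V\<close>]
  obtain X where "finite {i \<in> code_index K. X i \<noteq> topspace (discrete_topology (UNIV :: bool set))} \<and>
      (\<forall>i\<in>code_index K. openin (discrete_topology UNIV) (X i)) \<and>
      fst y \<in> PiE (code_index K) X \<and> PiE (code_index K) X \<subseteq> V"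
    by (rule exE)
  then have X: "finite {i \<in> code_index K. X i \<noteq> UNIV}" "fst y \<in> PiE (code_index K) X"
      "PiE (code_index K) X \<subseteq> V"
    by (simp_all only: topspace_discrete_topology)
  obtain ps where ps: "set ps = {i \<in> code_index K. X i \<noteq> UNIV}" using finite_list[OF X(1)] by blast
  define l where "l = map (\<lambda>p. (p, fst y p)) ps"
  show thesis
  proof (rule that[of l])
    show "set l \<subseteq> code_index K \<times> UNIV" unfolding l_def set_map ps by blast
    show "y \<in> cylinder K l" using UB U(2) unfolding cylinder_def l_def set_map by blast
    show "cylinder K l \<subseteq> U"
    proof
      fix y' assume y': "y' \<in> cylinder K l"
      then have y'B: "y' \<in> coded_ball K" and digits: "\<And>p. p \<in> set ps \<Longrightarrow> fst y' p = fst y p"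
        unfolding cylinder_def l_def set_map by blast+
      have "fst y' \<in> PiE (code_index K) X"
      proof (intro PiE_I)
        fix i assume i: "i \<in> code_index K"
        have "fst y i \<in> X i" using X(2) i by (rule PiE_mem)
        moreover have "fst y' i = fst y i" if "X i \<noteq> UNIV" using digits[of i] ps i that by blast
        ultimately show "fst y' i \<in> X i" by (cases "X i = UNIV") simp_all
      next
        fix i assume "i \<notin> code_index K"
        moreover have "fst y' \<in> extensional (code_index K)"
          using y'B unfolding coded_ball_def by auto
        ultimately show "fst y' i = undefined" by (rule extensional_arb[rotated])
      qed
      then have "fst y' \<in> fst ` U" using X(3) V(2) y'B by blast
      then obtain u where "u \<in> U" "fst u = fst y'" by auto
      moreover have "u \<in> coded_ball K" using \<open>u \<in> U\<close> UB by blast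
      ultimately have "u = y'"
        by (intro inj_onD[OF inj_on_fst_coded_ball[OF K] _ _ y'B])
      then show "y' \<in> U" using \<open>u \<in> U\<close> by simp
    qed
  qed
qed

lemma clopen_coded_space_finite_union:
  assumes K: "compact_space K" "Hausdorff_space K" "totally_disconnected_space K"
    and U: "U \<in> clopens (coded_space K)"
  obtains L where "\<forall>l\<in>set L. set l \<subseteq> code_index K \<times> UNIV" "U = (\<Union>l\<in>set L. cylinder K l)"
proof -
  define \<C> where "\<C> = {cylinder K l | l. set l \<subseteq> code_index K \<times> UNIV \<and> cylinder K l \<subseteq> U}"
  have "compactin (coded_space K) U"
    using U closedin_compact_space compact_coded_space clopensD(2) by blast
  moreover have "openin (coded_space K) C" if "C \<in> \<C>" for C
    using that openin_cylinder unfolding \<C>_def by blast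
  moreover have "U \<subseteq> \<Union>\<C>"
  proof
    fix y assume "y \<in> U"
    with K clopensD(1)[OF U] obtain l
      where "set l \<subseteq> code_index K \<times> UNIV" "y \<in> cylinder K l" "cylinder K l \<subseteq> U"
      by (rule openin_coded_space_contains_cylinder)
    then show "y \<in> \<Union>\<C>" unfolding \<C>_def by blast
  qed
  ultimately obtain \<F> where \<F>: "finite \<F>" "\<F> \<subseteq> \<C>" "U \<subseteq> \<Union>\<F>"
    using compactinD[of "coded_space K" U \<C>] by blast
  have "\<F> \<subseteq> cylinder K ` {l. set l \<subseteq> code_index K \<times> UNIV \<and> cylinder K l \<subseteq> U}"
    using \<F>(2) unfolding \<C>_def by blast
  from finite_subset_image[OF \<F>(1) this]
  obtain A where A: "A \<subseteq> {l. set l \<subseteq> code_index K \<times> UNIV \<and> cylinder K l \<subseteq> U}" "finite A" "\<F> = cylinder K ` A"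
    by blast
  obtain L where L: "set L = A" using A(2) finite_list by blast
  show thesis
  proof (rule that[of L])
    show "\<forall>l\<in>set L. set l \<subseteq> code_index K \<times> UNIV" using A(1) L by blast
    show "U = (\<Union>l\<in>set L. cylinder K l)" using A(1,3) L \<F>(3) by blast
  qed
qed

section \<open>Well-ordered chains of clopen sets\<close>

definition supported_on :: "'k topology \<Rightarrow> ('k set \<times> nat) set \<Rightarrow>
    (('k set \<times> nat \<Rightarrow> bool) \<times> (('k \<Rightarrow> real) \<Rightarrow> real)) set \<Rightarrow> bool" where
  "supported_on K S c \<longleftrightarrow> (\<forall>y\<in>coded_ball K. \<forall>y'\<in>coded_ball K.
     (\<forall>p\<in>S. fst y p = fst y' p) \<longrightarrow> (y \<in> c \<longleftrightarrow> y' \<in> c))"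

lemma supported_onD:
  assumes "supported_on K S c" "y \<in> coded_ball K" "y' \<in> coded_ball K"
    and "\<And>p. p \<in> S \<Longrightarrow> fst y p = fst y' p"
  shows "y \<in> c \<longleftrightarrow> y' \<in> c"
  using assms unfolding supported_on_def by blast

lemma supported_on_mono: "supported_on K S c \<Longrightarrow> S \<subseteq> S' \<Longrightarrow> supported_on K S' c"
  unfolding supported_on_def by (meson subsetD)

lemma clopen_coded_space_finite_support:
  assumes "compact_space K" "Hausdorff_space K" "totally_disconnected_space K"
    and "c \<in> clopens (coded_space K)"
  shows "\<exists>S. finite S \<and> supported_on K S c"
proof -
  obtain L where L: "c = (\<Union>l\<in>set L. cylinder K l)"
    using assms by (rule clopen_coded_space_finite_union)
  define S where "S = (\<Union>l\<in>set L. fst ` set l)"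
  have "y' \<in> c" if y: "y' \<in> coded_ball K" "\<forall>p\<in>S. fst y p = fst y' p" "y \<in> c" for y y'
  proof -
    obtain l where l: "l \<in> set L" "y \<in> cylinder K l" using y(3) unfolding L by blast
    have "fst y' p = b" if "(p, b) \<in> set l" for p b
    proof -
      have "p \<in> S" unfolding S_def using l(1) that by (intro UN_I image_eqI[of _ _ "(p, b)"]) simp_all
      moreover have "fst y p = b" using l(2) that unfolding cylinder_def by blast
      ultimately show ?thesis using y(2) by simp
    qed
    then have "y' \<in> cylinder K l" using y(1) unfolding cylinder_def by blast
    then show "y' \<in> c" unfolding L using l(1) by blast
  qed
  then have "supported_on K S c" unfolding supported_on_def by metis
  moreover have "finite S" unfolding S_def by simp
  ultimately show ?thesis by blast
qed

text \<open>The point at time \<open>t\<close> of the segment from \<open>\<Lambda>\<close> to \<open>\<Lambda>'\<close> in the dual ball.\<close>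

definition segment_functional ::
    "'k topology \<Rightarrow> (('k \<Rightarrow> real) \<Rightarrow> real) \<Rightarrow> (('k \<Rightarrow> real) \<Rightarrow> real) \<Rightarrow> real \<Rightarrow> ('k \<Rightarrow> real) \<Rightarrow> real" where
  "segment_functional K \<Lambda> \<Lambda>' t = (\<lambda>f\<in>cont_funs K. (1 - t) * \<Lambda> f + t * \<Lambda>' f)"

lemma segment_functional_ends:
  assumes "\<Lambda> \<in> dual_ball K" "\<Lambda>' \<in> dual_ball K"
  shows "segment_functional K \<Lambda> \<Lambda>' 0 = \<Lambda>" "segment_functional K \<Lambda> \<Lambda>' 1 = \<Lambda>'"
  using assms by (auto simp: segment_functional_def dual_ball_def extensional_restrict)

lemma continuous_map_segment_functional:
  "continuous_map euclideanreal (functional_topology K) (segment_functional K \<Lambda> \<Lambda>')"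
  unfolding functional_topology_def continuous_map_componentwise
proof (intro conjI ballI)
  show "segment_functional K \<Lambda> \<Lambda>' ` topspace euclideanreal \<subseteq> extensional (cont_funs K)"
    by (auto simp: segment_functional_def)
  fix f assume "f \<in> cont_funs K"
  then have "(\<lambda>t. segment_functional K \<Lambda> \<Lambda>' t f) = (\<lambda>t. (1 - t) * \<Lambda> f + t * \<Lambda>' f)"
    by (simp add: segment_functional_def)
  then show "continuous_map euclideanreal euclideanreal (\<lambda>t. segment_functional K \<Lambda> \<Lambda>' t f)"
    by (auto intro!: continuous_intros)
qed

lemma closed_segment_parameters:
  assumes "closedin (coded_space K) Q"
  shows "closed {t. segment_functional K \<Lambda> \<Lambda>' t \<in> snd ` Q}"
proof -
  have "compactin (functional_topology K) (snd ` Q)"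
    using image_compactin[OF closedin_compact_space[OF compact_coded_space assms]
        continuous_map_snd_coded_space] .
  then have "closedin (functional_topology K) (snd ` Q)"
    by (rule compactin_imp_closedin[OF Hausdorff_functional_topology])
  then have "closedin euclideanreal
      {t \<in> topspace euclideanreal. segment_functional K \<Lambda> \<Lambda>' t \<in> snd ` Q}"
    by (rule closedin_continuous_map_preimage[OF continuous_map_segment_functional])
  then show ?thesis by simp
qed

text \<open>Along a segment in the dual ball, digits that agree at both ends can be kept constant. This is
where convexity of the dual ball and of the digit intervals is used.\<close>

lemma segment_lifts_to_codes:
  assumes y: "(z, \<Lambda>) \<in> coded_ball K" "(z', \<Lambda>') \<in> coded_ball K"
    and agree: "\<And>U n. U \<in> R \<Longrightarrow> n < N \<Longrightarrow> z (U, n) = z' (U, n)"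
    and t: "0 \<le> t" "t \<le> 1"
  obtains x where "(x, segment_functional K \<Lambda> \<Lambda>' t) \<in> coded_ball K"
    "\<forall>U\<in>R. \<forall>n<N. x (U, n) = z (U, n)"
proof -
  let ?M = "segment_functional K \<Lambda> \<Lambda>' t"
  \<comment> \<open>No digits are prescribed outside \<open>R\<close>; the bound for the empty prefix is just the norm bound.\<close>
  define N' where "N' U = (if U \<in> R then N else 0)" for U
  have "?M \<in> dual_ball K"
    unfolding segment_functional_def
    by (rule dual_ball_convex) (use y t in \<open>auto simp: coded_ball_def\<close>)
  moreover have "\<bar>?M (indicator U) - signed_sum (\<lambda>n. z (U, n)) (N' U)\<bar> \<le> 1 / 2 ^ N' U"
    if U: "U \<in> clopens K" for U
  proof -
    have "?M (indicator U) = (1 - t) * \<Lambda> (indicator U) + t * \<Lambda>' (indicator U)"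
      using indicator_cont_funs[OF U] by (simp add: segment_functional_def)
    moreover have "\<bar>(1 - t) * \<Lambda> (indicator U) + t * \<Lambda>' (indicator U) - signed_sum (\<lambda>n. z (U, n)) (N' U)\<bar>
        \<le> 1 / 2 ^ N' U"
    proof (rule sign_code_convex)
      show "sign_code (\<lambda>n. z (U, n)) (\<Lambda> (indicator U))" "sign_code (\<lambda>n. z' (U, n)) (\<Lambda>' (indicator U))"
        using y U unfolding coded_ball_def by auto
      show "z (U, n) = z' (U, n)" if "n < N' U" for n
        using agree[of U n] that by (simp add: N'_def split: if_splits)
    qed (use t in auto)
    ultimately show ?thesis by simp
  qed
  ultimately have "\<exists>x. (x, ?M) \<in> coded_ball K \<and> (\<forall>U\<in>clopens K. \<forall>n<N' U. x (U, n) = z (U, n))"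
    by (rule dual_ball_has_codes)
  then obtain x where x: "(x, ?M) \<in> coded_ball K" "\<forall>U\<in>clopens K. \<forall>n<N' U. x (U, n) = z (U, n)"
    by blast
  have "x (U, n) = z (U, n)" if "U \<in> R" "n < N" for U n
  proof (cases "U \<in> clopens K")
    case True
    then show ?thesis using x(2) that by (simp add: N'_def)
  next
    case False
    then have "(U, n) \<notin> code_index K" by (simp add: code_index_def)
    then show ?thesis
      using coded_ball_extensional[OF x(1)] coded_ball_extensional[OF y(1)] by (simp add: extensional_def)
  qed
  then show thesis using x(1) by (intro that) auto
qed

text \<open>Codes of the same functional can be exchanged on any set \<open>F\<close> of clopen sets.\<close>

lemma coded_ball_mix:
  assumes "(z, \<Lambda>) \<in> coded_ball K" "(z', \<Lambda>) \<in> coded_ball K"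
  shows "(\<lambda>p. if fst p \<in> F then z' p else z p, \<Lambda>) \<in> coded_ball K"
proof -
  have "sign_code (\<lambda>n. if U \<in> F then z' (U, n) else z (U, n)) (\<Lambda> (indicator U))" if "U \<in> clopens K" for U
    using assms that unfolding coded_ball_def by (cases "U \<in> F") auto
  then show ?thesis using assms by (auto simp: coded_ball_def extensional_def)
qed

lemma Sup_of_closed_cover:
  fixes E D :: "real set"
  assumes "closed E" "closed D" "E \<subseteq> {0..1}" "{0..1} \<subseteq> E \<union> D" "0 \<in> E" "1 \<in> D"
  shows "Sup E \<in> E" "Sup E \<in> D"
proof -
  have bdd: "bdd_above E" using assms(3) by (meson bdd_above_Icc bdd_above_mono)
  show E: "Sup E \<in> E" using closed_contains_Sup[OF _ bdd assms(1)] assms(5) by blast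
  show "Sup E \<in> D"
  proof (rule ccontr)
    assume nD: "Sup E \<notin> D"
    then obtain e where e: "0 < e" "\<And>x. dist x (Sup E) < e \<Longrightarrow> x \<notin> D"
      using assms(2) unfolding closed_def open_dist by (metis ComplD ComplI)
    have "Sup E < 1" using nD assms(3,6) E by (metis atLeastAtMost_iff order_less_le subsetD)
    define x where "x = min 1 (Sup E + e / 2)"
    have x: "Sup E < x" "x \<le> 1" "dist x (Sup E) < e"
      using \<open>Sup E < 1\<close> e(1) by (auto simp: x_def dist_real_def min_def)
    have "0 \<le> Sup E" using E assms(3) by auto
    then have "x \<in> {0..1}" using x by simp
    then have "x \<in> E" using e(2)[OF x(3)] assms(4) by blast
    then show False using cSup_upper[OF _ bdd, of x] x(1) by simp
  qed
qed

definition digit_block :: "'k topology \<Rightarrow> ('k set \<times> nat) set \<Rightarrow> ('k set \<times> nat \<Rightarrow> bool) \<Rightarrow>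
    (('k set \<times> nat \<Rightarrow> bool) \<times> (('k \<Rightarrow> real) \<Rightarrow> real)) set" where
  "digit_block K P \<rho> = {y \<in> coded_ball K. \<forall>p\<in>P. fst y p = \<rho> p}"

lemma digit_blockD:
  "y \<in> digit_block K P \<rho> \<Longrightarrow> y \<in> coded_ball K"
  "y \<in> digit_block K P \<rho> \<Longrightarrow> p \<in> P \<Longrightarrow> fst y p = \<rho> p"
  by (auto simp: digit_block_def)

lemma closedin_digit_block: "closedin (coded_space K) (digit_block K P \<rho>)"
proof -
  have "closedin (coded_space K) {y \<in> topspace (coded_space K). \<forall>p\<in>P. fst y p = \<rho> p}"
  proof (rule closedin_Collect_ball)
    fix p assume p: "p \<in> P"
    show "closedin (coded_space K) {y \<in> topspace (coded_space K). fst y p = \<rho> p}"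
    proof (cases "p \<in> code_index K")
      case True
      have "continuous_map (coded_space K) (discrete_topology UNIV) (\<lambda>y. fst y p)"
        unfolding coded_space_def
        by (rule continuous_map_from_subtopology[OF continuous_map_code_coordinate[OF True]])
      from closedin_continuous_map_preimage[OF this, of "{\<rho> p}"] show ?thesis by simp
    next
      case False
      have "fst y p = undefined" if "y \<in> coded_ball K" for y
        using extensional_arb[OF coded_ball_extensional[OF that] False] .
      then have "{y \<in> topspace (coded_space K). fst y p = \<rho> p} \<in> {{}, topspace (coded_space K)}"
        unfolding topspace_coded_space by (cases "\<rho> p = undefined") auto
      then show ?thesis
        by (elim insertE emptyE) (simp_all only: closedin_empty closedin_topspace)
    qed
  qed
  then show ?thesis by (simp add: digit_block_def topspace_coded_space)
qed

lemma closedin_block_parts: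
  assumes "c \<in> clopens (coded_space K)"
  shows "closedin (coded_space K) (c \<inter> digit_block K P \<rho>)"
    and "closedin (coded_space K) (digit_block K P \<rho> - c)"
  using closedin_Int[OF clopensD(2)[OF assms] closedin_digit_block]
    closedin_diff[OF closedin_digit_block clopensD(1)[OF assms]] by blast+

text \<open>The heart of the argument. Join the functionals of \<open>y0\<close> and \<open>y1\<close> by a segment and let
\<open>\<tau> c\<close> be the last time at which some code with the common digits lies in \<open>c\<close>. Both the
times that allow a code in \<open>c\<close> and those that allow a code outside \<open>c\<close> form closed sets, so at
time \<open>\<tau> c\<close> both kinds of codes exist: the functional has dyadic values there and \<open>c\<close> depends on
the choice of expansions. If \<open>c \<subseteq> d\<close> and the two sets look at different clopen
sets outside \<open>R\<close>, then no time can allow a code in \<open>c\<close> and a code outside \<open>d\<close>, since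
mixing the two codes would give a point of \<open>c\<close> outside \<open>d\<close>. Hence \<open>d\<close> switches strictly
later than \<open>c\<close>.\<close>

lemma switching_times:
  fixes K :: "'k topology"
  assumes y0: "y0 \<in> digit_block K (R \<times> {..<N}) \<rho>" and y1: "y1 \<in> digit_block K (R \<times> {..<N}) \<rho>"
    and clopen: "\<And>c. c \<in> X \<Longrightarrow> c \<in> clopens (coded_space K)"
    and sep: "\<And>c. c \<in> X \<Longrightarrow> y0 \<in> c \<and> y1 \<notin> c"
    and supp: "\<And>c. c \<in> X \<Longrightarrow> supported_on K (F c \<times> {..<N}) c"
  shows "\<exists>\<tau> :: _ \<Rightarrow> real. (\<forall>c\<in>X. \<tau> c \<le> 1) \<and>
    (\<forall>c\<in>X. \<forall>d\<in>X. c \<subseteq> d \<longrightarrow> F c \<inter> F d = R \<longrightarrow> \<tau> c < \<tau> d)"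
proof -
  let ?blk = "digit_block K (R \<times> {..<N}) \<rho>"
  obtain z0 \<Lambda>0 where z0: "y0 = (z0, \<Lambda>0)" by (cases y0)
  obtain z1 \<Lambda>1 where z1: "y1 = (z1, \<Lambda>1)" by (cases y1)
  have ball: "(z0, \<Lambda>0) \<in> coded_ball K" "(z1, \<Lambda>1) \<in> coded_ball K"
    using y0 y1 unfolding z0 z1 by (auto dest: digit_blockD(1))
  have pattern: "z0 p = \<rho> p" "z1 p = \<rho> p" if "p \<in> R \<times> {..<N}" for p
    using digit_blockD(2)[OF y0 that] digit_blockD(2)[OF y1 that] unfolding z0 z1 by simp_all
  let ?M = "segment_functional K \<Lambda>0 \<Lambda>1"
  have ends: "?M 0 = \<Lambda>0" "?M 1 = \<Lambda>1"
    using ball by (auto simp: coded_ball_def intro: segment_functional_ends)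
  define E where "E c = {0..1} \<inter> {t. ?M t \<in> snd ` (c \<inter> ?blk)}" for c
  define D where "D c = {0..1} \<inter> {t. ?M t \<in> snd ` (?blk - c)}" for c
  have cover: "{0..1} \<subseteq> E c \<union> D c" for c
  proof
    fix t :: real assume t: "t \<in> {0..1}"
    obtain x where x: "(x, ?M t) \<in> coded_ball K" "\<forall>U\<in>R. \<forall>n<N. x (U, n) = z0 (U, n)"
    proof (rule segment_lifts_to_codes[OF ball, of R N t])
      show "z0 (U, n) = z1 (U, n)" if "U \<in> R" "n < N" for U n
        using pattern[of "(U, n)"] that by simp
    qed (use t in auto)
    have "(x, ?M t) \<in> ?blk" using x pattern(1) unfolding digit_block_def by auto
    then have "?M t \<in> snd ` (c \<inter> ?blk) \<or> ?M t \<in> snd ` (?blk - c)"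
      by (cases "(x, ?M t) \<in> c") (auto intro: rev_image_eqI)
    then show "t \<in> E c \<union> D c" using t unfolding E_def D_def by blast
  qed
  \<comment> \<open>\<open>E c\<close> and \<open>D c\<close> collect the times that allow a code of the block inside and outside \<open>c\<close>.\<close>
  define \<tau> where "\<tau> c = Sup (E c)" for c
  have \<tau>: "\<tau> c \<in> E c" "\<tau> c \<in> D c" if "c \<in> X" for c
  proof -
    have "closed (E c)" unfolding E_def
      by (intro closed_Int closed_segment_parameters closedin_block_parts clopen[OF that]) simp
    moreover have "closed (D c)" unfolding D_def
      by (intro closed_Int closed_segment_parameters closedin_block_parts clopen[OF that]) simp
    moreover have "E c \<subseteq> {0..1}" unfolding E_def by blast
    moreover have "0 \<in> E c"
      using sep[OF that] y0 ends(1) unfolding E_def z0 by (auto intro: rev_image_eqI)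
    moreover have "1 \<in> D c"
      using sep[OF that] y1 ends(2) unfolding D_def z1 by (auto intro: rev_image_eqI)
    ultimately show "\<tau> c \<in> E c" "\<tau> c \<in> D c"
      unfolding \<tau>_def by (auto intro: Sup_of_closed_cover[OF _ _ _ cover])
  qed
  have disjoint: "E c \<inter> D d = {}" if cd: "c \<in> X" "d \<in> X" "c \<subseteq> d" "F c \<inter> F d = R" for c d
  proof (rule ccontr)
    assume "E c \<inter> D d \<noteq> {}"
    then obtain t z z' where z: "(z, ?M t) \<in> c \<inter> ?blk" and z': "(z', ?M t) \<in> ?blk - d"
      unfolding E_def D_def by (fastforce simp: image_iff)
    \<comment> \<open>On \<open>R\<close> the two codes share the first \<open>N\<close> digits, so \<open>x\<close> looks like \<open>z\<close> to \<open>c\<close> and like \<open>z'\<close> to \<open>d\<close>.\<close>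
    define x where "x = (\<lambda>p. if fst p \<in> F d - R then z' p else z p)"
    have zB: "(z, ?M t) \<in> coded_ball K" "(z', ?M t) \<in> coded_ball K"
      using z z' by (auto dest: digit_blockD(1))
    then have xB: "(x, ?M t) \<in> coded_ball K" unfolding x_def by (rule coded_ball_mix)
    have "(x, ?M t) \<in> c \<longleftrightarrow> (z, ?M t) \<in> c"
    proof (rule supported_onD[OF supp[OF cd(1)] xB zB(1)])
      fix p assume "p \<in> F c \<times> {..<N}"
      then show "fst (x, ?M t) p = fst (z, ?M t) p" using cd(4) by (auto simp: x_def)
    qed
    moreover have "(x, ?M t) \<in> d \<longleftrightarrow> (z', ?M t) \<in> d"
    proof (rule supported_onD[OF supp[OF cd(2)] xB zB(2)])
      fix p assume p: "p \<in> F d \<times> {..<N}"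
      show "fst (x, ?M t) p = fst (z', ?M t) p"
      proof (cases "fst p \<in> R")
        case True
        then have pR: "p \<in> R \<times> {..<N}" using p by auto
        have "z p = \<rho> p" "z' p = \<rho> p"
          using digit_blockD(2)[OF IntD2[OF z] pR] digit_blockD(2)[OF DiffD1[OF z'] pR] by simp_all
        then show ?thesis by (simp add: x_def)
      next
        case False
        then show ?thesis using p by (auto simp: x_def)
      qed
    qed
    ultimately show False using z z' cd(3) by blast
  qed
  have "\<tau> c < \<tau> d" if cd: "c \<in> X" "d \<in> X" "c \<subseteq> d" "F c \<inter> F d = R" for c d
  proof -
    have "\<tau> c \<notin> D d" "\<tau> d \<notin> E c" using disjoint[OF cd] \<tau>[OF cd(1)] \<tau>[OF cd(2)] by blast+
    moreover have "\<tau> c \<in> {0..1}" using \<tau>(1)[OF cd(1)] unfolding E_def by blast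
    ultimately have "\<tau> c \<in> E d" using cover by blast
    moreover have "bdd_above (E d)" unfolding E_def by (meson bdd_above_Icc bdd_above_mono inf_le1)
    ultimately have "\<tau> c \<le> \<tau> d" unfolding \<tau>_def[of d] by (rule cSup_upper)
    moreover have "\<tau> c \<noteq> \<tau> d" using \<open>\<tau> d \<notin> E c\<close> \<tau>(1)[OF cd(1)] by metis
    ultimately show ?thesis by simp
  qed
  moreover have "\<tau> c \<le> 1" if "c \<in> X" for c using \<tau>(1)[OF that] unfolding E_def by simp
  ultimately show ?thesis by blast
qed

text \<open>Compactness, as the finite subfamilies of a chain have largest members.\<close>

lemma digit_block_not_covered_by_chain:
  assumes clopen: "X \<subseteq> clopens (coded_space K)" and ne: "X \<noteq> {}"
    and chain: "\<And>c d. c \<in> X \<Longrightarrow> d \<in> X \<Longrightarrow> c \<subseteq> d \<or> d \<subseteq> c"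
    and proper: "\<And>c. c \<in> X \<Longrightarrow> digit_block K P \<rho> - c \<noteq> {}"
  shows "\<exists>y\<in>digit_block K P \<rho>. \<forall>c\<in>X. y \<notin> c"
proof -
  let ?blk = "digit_block K P \<rho>"
  have "\<Inter> ((\<lambda>c. ?blk - c) ` X) \<noteq> {}"
  proof (rule compact_space_fip[THEN iffD1, rule_format, OF compact_coded_space], intro conjI allI impI ballI)
    fix Q assume "Q \<in> (\<lambda>c. ?blk - c) ` X"
    then obtain c where c: "c \<in> X" "Q = ?blk - c" by blast
    show "closedin (coded_space K) Q"
      unfolding c(2) by (rule closedin_block_parts(2)[OF subsetD[OF clopen c(1)]])
  next
    fix \<F> assume \<F>: "finite \<F> \<and> \<F> \<subseteq> (\<lambda>c. ?blk - c) ` X"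
    then obtain A where A: "A \<subseteq> X" "finite A" "\<F> = (\<lambda>c. ?blk - c) ` A"
      by (meson finite_subset_image)
    have "\<exists>m\<in>X. \<forall>c\<in>A. c \<subseteq> m" using A(2,1)
    proof (induction A rule: finite_induct)
      case empty
      then show ?case using ne by blast
    next
      case (insert a A)
      then obtain m where m: "m \<in> X" "\<forall>c\<in>A. c \<subseteq> m" by auto
      show ?case
      proof (cases "a \<subseteq> m")
        case True
        then show ?thesis using m by blast
      next
        case False
        then have "m \<subseteq> a" using chain m(1) insert.prems by blast
        then show ?thesis using m insert.prems by (intro bexI[of _ a]) auto
      qed
    qed
    then obtain m where m: "m \<in> X" "\<forall>c\<in>A. c \<subseteq> m" by blast
    then show "\<Inter>\<F> \<noteq> {}" using proper[OF m(1)] A(3) by blast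
  qed
  then show ?thesis using ne by blast
qed

text \<open>An uncountable chain is thinned out until all its members have codes of the same depth
\<open>N\<close>, have supports meeting pairwise in a finite set \<open>R\<close> (up to countably many exceptions),
and are told apart already inside one block where the first \<open>N\<close> digits over \<open>R\<close> are fixed. In
that block there are a point \<open>y0\<close> of all members and a point \<open>y1\<close> of none, so the switching times
along the segment between them would give a strictly increasing real function, again up to
countably many exceptions, on an uncountable chain whose initial segments are countable.\<close>

lemma countable_coded_chain:
  assumes K: "compact_space K" "Hausdorff_space K" "totally_disconnected_space K"
    and C: "C \<subseteq> clopens (coded_space K)"
    and chain: "\<And>c d. c \<in> C \<Longrightarrow> d \<in> C \<Longrightarrow> c \<subseteq> d \<or> d \<subseteq> c"
    and initial: "\<And>c. c \<in> C \<Longrightarrow> countable {d \<in> C. d \<subseteq> c}"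
  shows "countable C"
proof (rule ccontr)
  assume unc: "uncountable C"
  have CB: "c \<subseteq> coded_ball K" if "c \<in> C" for c
    using C that clopensD(3) topspace_coded_space by blast
  have "\<forall>c\<in>C. \<exists>S. finite S \<and> supported_on K S c"
    using C clopen_coded_space_finite_support[OF K] by blast
  from bchoice[OF this] obtain S where S: "\<forall>c\<in>C. finite (S c) \<and> supported_on K (S c) c"
    by (rule exE)
  define F where "F c = fst ` S c" for c
  have finF: "finite (F c)" if "c \<in> C" for c using S that by (simp add: F_def)
  \<comment> \<open>The number \<open>N\<close> exceeds all digit positions in the support; inserting 0 covers empty supports.\<close>
  obtain N where N: "uncountable {c \<in> C. Suc (Max (insert 0 (snd ` S c))) = N}"
    using unc by (rule uncountable_fibre)
  define C1 where "C1 = {c \<in> C. Suc (Max (insert 0 (snd ` S c))) = N}"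
  have supp: "supported_on K (F c \<times> {..<N}) c" if "c \<in> C1" for c
  proof -
    have c: "finite (S c)" "Suc (Max (insert 0 (snd ` S c))) = N" "supported_on K (S c) c"
      using that S unfolding C1_def by blast+
    have "S c \<subseteq> F c \<times> {..<N}"
    proof
      fix p assume p: "p \<in> S c"
      then have "snd p \<le> Max (insert 0 (snd ` S c))" using c(1) by (intro Max_ge) auto
      then have "snd p < N" using c(2) by simp
      moreover have "fst p \<in> F c" using p by (simp add: F_def)
      ultimately show "p \<in> F c \<times> {..<N}" by (simp add: mem_Times_iff)
    qed
    moreover note c(3)
    ultimately show ?thesis by (rule supported_on_mono[rotated])
  qed
  have "uncountable C1" using N unfolding C1_def .
  moreover have "finite (F c)" if "c \<in> C1" for c using finF that unfolding C1_def by blast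
  ultimately obtain C2 R where C2: "C2 \<subseteq> C1" "uncountable C2" and R: "finite R"
      "\<forall>c\<in>C2. countable {d \<in> C2. F c \<inter> F d \<noteq> R}"
    by (rule uncountable_root)
  define P where "P = PiE (R \<times> {..<N}) (\<lambda>_. UNIV :: bool set)"
  let ?blk = "digit_block K (R \<times> {..<N})"
  have C2C: "C2 \<subseteq> C" using C2(1) unfolding C1_def by blast
  have finP: "finite P" unfolding P_def using R(1) by (intro finite_PiE) auto
  have blk_cover: "\<exists>\<rho>\<in>P. y \<in> ?blk \<rho>" if "y \<in> coded_ball K" for y
    using that by (intro bexI[of _ "restrict (fst y) (R \<times> {..<N})"]) (auto simp: digit_block_def P_def)
  \<comment> \<open>The finitely many blocks partition the ball, so an uncountable family has uncountably many traces on one of them.\<close>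
  have inj: "inj_on (\<lambda>c. \<lambda>\<rho>\<in>P. c \<inter> ?blk \<rho>) C2"
  proof (rule inj_onI)
    fix c d assume cd: "c \<in> C2" "d \<in> C2" "(\<lambda>\<rho>\<in>P. c \<inter> ?blk \<rho>) = (\<lambda>\<rho>\<in>P. d \<inter> ?blk \<rho>)"
    have "c \<inter> ?blk \<rho> = d \<inter> ?blk \<rho>" if "\<rho> \<in> P" for \<rho>
      using fun_cong[OF cd(3), of \<rho>] that by simp
    moreover have "c \<subseteq> coded_ball K" "d \<subseteq> coded_ball K" using CB cd(1,2) C2C by blast+
    ultimately show "c = d" using blk_cover by blast
  qed
  obtain \<rho> where unc_\<rho>: "uncountable ((\<lambda>c. c \<inter> ?blk \<rho>) ` C2)"
    by (rule uncountable_image_of_finite_decomposition[OF C2(2) finP inj])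
  \<comment> \<open>One member of the chain is kept for each trace, so that strict inclusions remain strict in the block.\<close>
  obtain C3 where C3: "C3 \<subseteq> C2" "inj_on (\<lambda>c. c \<inter> ?blk \<rho>) C3" "uncountable C3"
  proof -
    have "\<exists>X\<subseteq>C2. inj_on (\<lambda>c. c \<inter> ?blk \<rho>) X \<and> (\<lambda>c. c \<inter> ?blk \<rho>) ` C2 = (\<lambda>c. c \<inter> ?blk \<rho>) ` X"
      using subset_image_inj[of "(\<lambda>c. c \<inter> ?blk \<rho>) ` C2" "\<lambda>c. c \<inter> ?blk \<rho>" C2] by simp
    then obtain X where X: "X \<subseteq> C2" "inj_on (\<lambda>c. c \<inter> ?blk \<rho>) X"
      "(\<lambda>c. c \<inter> ?blk \<rho>) ` C2 = (\<lambda>c. c \<inter> ?blk \<rho>) ` X"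
      by blast
    have "uncountable X"
    proof
      assume "countable X"
      then have "countable ((\<lambda>c. c \<inter> ?blk \<rho>) ` X)" by (rule countable_image)
      then show False using unc_\<rho> unfolding X(3) by simp
    qed
    with X(1,2) show thesis by (rule that)
  qed
  have C3C: "C3 \<subseteq> C" using C3(1) C2C by blast
  have ne: "C3 \<noteq> {}" using C3(3) by auto
  have later: "\<exists>d\<in>C3. c \<subseteq> d \<and> d \<inter> ?blk \<rho> - c \<noteq> {}" if c: "c \<in> C3" for c
  proof -
    have "\<exists>d\<in>C3. \<not> d \<subseteq> c"
    proof (rule ccontr)
      assume "\<not> ?thesis"
      then have "d \<subseteq> c" if "d \<in> C3" for d using that by metis
      then have "C3 \<subseteq> {d \<in> C. d \<subseteq> c}" using C3C by (simp add: subset_iff[of C3])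
      moreover have "countable {d \<in> C. d \<subseteq> c}" by (rule initial[OF subsetD[OF C3C c]])
      ultimately have "countable C3" by (rule countable_subset)
      then show False using C3(3) by simp
    qed
    then obtain d where d: "d \<in> C3" "\<not> d \<subseteq> c" by blast
    then have "c \<subseteq> d" using chain[OF subsetD[OF C3C c] subsetD[OF C3C d(1)]] by blast
    moreover have "c \<inter> ?blk \<rho> \<noteq> d \<inter> ?blk \<rho>" using inj_onD[OF C3(2) _ c d(1)] d(2) by blast
    ultimately show ?thesis using d(1) by blast
  qed
  have "\<exists>y\<in>?blk \<rho>. \<forall>c\<in>C3. y \<notin> c"
  proof (rule digit_block_not_covered_by_chain)
    show "C3 \<subseteq> clopens (coded_space K)" using C3C C by (rule subset_trans)
    show "c \<subseteq> d \<or> d \<subseteq> c" if "c \<in> C3" "d \<in> C3" for c d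
      using chain[OF subsetD[OF C3C that(1)] subsetD[OF C3C that(2)]] .
    show "?blk \<rho> - c \<noteq> {}" if "c \<in> C3" for c using later[OF that] by blast
  qed (rule ne)
  then obtain y1 where y1: "y1 \<in> ?blk \<rho>" "\<forall>c\<in>C3. y1 \<notin> c" by blast
  obtain c where c: "c \<in> C3" using ne by blast
  obtain c0 where c0_C3: "c0 \<in> C3" and "c0 \<inter> ?blk \<rho> - c \<noteq> {}" using later[OF c] by blast
  then obtain y0 where "y0 \<in> c0" "y0 \<in> ?blk \<rho>" by blast
  note c0 = c0_C3 this
  \<comment> \<open>Discarding the countably many members below \<open>c0\<close> leaves only sets containing \<open>y0\<close>.\<close>
  define C4 where "C4 = {c \<in> C3. c0 \<subseteq> c}"
  have unc4: "uncountable C4"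
  proof
    assume "countable C4"
    moreover have "countable {d \<in> C. d \<subseteq> c0}" by (rule initial[OF subsetD[OF C3C c0(1)]])
    ultimately have "countable (C4 \<union> {d \<in> C. d \<subseteq> c0})" by simp
    moreover have "C3 \<subseteq> C4 \<union> {d \<in> C. d \<subseteq> c0}"
      unfolding C4_def using chain[of c0] c0(1) C3C by blast
    ultimately have "countable C3" by (rule countable_subset[rotated])
    then show False using C3(3) by simp
  qed
  have C4: "c \<in> C" "c \<in> C1" "c \<in> C2" "y0 \<in> c \<and> y1 \<notin> c" if "c \<in> C4" for c
    using that c0(2) y1(2) C3C C3(1) C2(1) unfolding C4_def by blast+
  have "\<exists>\<tau> :: _ \<Rightarrow> real. (\<forall>c\<in>C4. \<tau> c \<le> 1) \<and>
      (\<forall>c\<in>C4. \<forall>d\<in>C4. c \<subseteq> d \<longrightarrow> F c \<inter> F d = R \<longrightarrow> \<tau> c < \<tau> d)"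
  proof (rule switching_times[OF c0(3) y1(1)])
    fix c assume c: "c \<in> C4"
    show "c \<in> clopens (coded_space K)" by (rule subsetD[OF C C4(1)[OF c]])
    show "y0 \<in> c \<and> y1 \<notin> c" by (rule C4(4)[OF c])
    show "supported_on K (F c \<times> {..<N}) c" by (rule supp[OF C4(2)[OF c]])
  qed
  then obtain \<tau> :: "_ \<Rightarrow> real" where \<tau>: "\<forall>c\<in>C4. \<tau> c \<le> 1"
    and less: "\<forall>c\<in>C4. \<forall>d\<in>C4. c \<subseteq> d \<longrightarrow> F c \<inter> F d = R \<longrightarrow> \<tau> c < \<tau> d"
    by (elim exE conjE)
  have "countable C4"
  proof (rule countable_if_countable_real_sublevels[of _ \<tau>])
    fix c assume c: "c \<in> C4"
    have "{d \<in> C4. \<tau> d \<le> \<tau> c} \<subseteq> {d \<in> C. d \<subseteq> c} \<union> {d \<in> C2. F c \<inter> F d \<noteq> R}"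
    proof
      fix d assume d: "d \<in> {d \<in> C4. \<tau> d \<le> \<tau> c}"
      then have "\<not> (c \<subseteq> d \<and> F c \<inter> F d = R)" using bspec[OF bspec[OF less c], of d] by auto
      then show "d \<in> {d \<in> C. d \<subseteq> c} \<union> {d \<in> C2. F c \<inter> F d \<noteq> R}"
        using d C4[of d] chain[OF C4(1)[OF c], of d] by blast
    qed
    moreover have "countable ({d \<in> C. d \<subseteq> c} \<union> {d \<in> C2. F c \<inter> F d \<noteq> R})"
      using initial[OF C4(1)[OF c]] bspec[OF R(2) C4(3)[OF c]] by simp
    ultimately show "countable {d \<in> C4. \<tau> d \<le> \<tau> c}" by (rule countable_subset)
  next
    show "bdd_above (\<tau> ` C4)" using \<tau> by (intro bdd_aboveI[of _ 1]) auto
  qed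
  then show False using unc4 by simp
qed

section \<open>The isometric embedding\<close>

text \<open>The embedding sends \<open>f\<close> to evaluation at \<open>f\<close>. It does not increase norms because the
functionals lie in the unit ball, and it does not decrease them because point evaluations do
too.\<close>

lemma C_coded_space_contains_isometric_copy:
  assumes "compact_space K"
  shows "C_contains_isometric_copy (coded_space K) K"
proof -
  define T where "T f y = (if y \<in> coded_ball K then snd y f else 0)"
    for f :: "'a \<Rightarrow> real" and y :: "('a set \<times> nat \<Rightarrow> bool) \<times> (('a \<Rightarrow> real) \<Rightarrow> real)"
  have T: "T f \<in> cont_funs (coded_space K)" if "f \<in> cont_funs K" for f
  proof -
    have "continuous_map (coded_space K) euclideanreal (\<lambda>y. snd y f)"
      unfolding coded_space_def
      by (rule continuous_map_from_subtopology[OF continuous_map_functional_coordinate[OF that]])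
    then have "continuous_map (coded_space K) euclideanreal (T f)"
      by (rule continuous_map_eq) (simp add: T_def topspace_coded_space)
    then show ?thesis by (simp add: cont_funs_def T_def topspace_coded_space)
  qed
  have ball: "snd y \<in> dual_ball K" if "y \<in> coded_ball K" for y
    using that by (auto simp: coded_ball_def)
  have "sup_norm (coded_space K) (T f) = sup_norm K f" if f: "f \<in> cont_funs K" for f
  proof (rule antisym)
    show "sup_norm (coded_space K) (T f) \<le> sup_norm K f"
    proof (rule sup_norm_leI)
      \<comment> \<open>The norm bound holds at every element of the type, so any argument shows nonnegativity, even if the space is empty.\<close>
      show "0 \<le> sup_norm K f" using abs_le_sup_norm[OF assms f, of undefined] by linarith
      fix y assume "y \<in> topspace (coded_space K)"
      then show "\<bar>T f y\<bar> \<le> sup_norm K f"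
        using dual_ballD(3)[OF ball f] by (simp add: T_def topspace_coded_space)
    qed
    show "sup_norm K f \<le> sup_norm (coded_space K) (T f)"
    proof (rule sup_norm_leI)
      show "0 \<le> sup_norm (coded_space K) (T f)"
        using abs_le_sup_norm[OF compact_coded_space T[OF f], of undefined] by linarith
      fix x assume "x \<in> topspace K"
      define \<delta> where "\<delta> = (\<lambda>f\<in>cont_funs K. f x)"
      have \<delta>: "\<delta> \<in> dual_ball K"
        unfolding \<delta>_def by (rule point_evaluation_in_dual_ball[OF assms])
      have "\<bar>\<delta> (indicator U) - signed_sum (\<lambda>_. True) 0\<bar> \<le> 1 / 2 ^ 0" if "U \<in> clopens K" for U
        using indicator_cont_funs[OF that] by (simp add: \<delta>_def signed_sum_def indicator_def)
      from dual_ball_has_codes[OF \<delta> this] obtain z where "(z, \<delta>) \<in> coded_ball K" by blast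
      then have "f x = T f (z, \<delta>)" using f by (simp add: T_def \<delta>_def)
      then show "\<bar>f x\<bar> \<le> sup_norm (coded_space K) (T f)"
        using abs_le_sup_norm[OF compact_coded_space T[OF f]] by simp
    qed
  qed
  moreover have "T (\<lambda>x. f x + g x) = (\<lambda>y. T f y + T g y)" if "f \<in> cont_funs K" "g \<in> cont_funs K" for f g
    using dual_ballD(1)[OF ball that] by (auto simp: T_def)
  moreover have "T (\<lambda>x. c * f x) = (\<lambda>y. c * T f y)" if "f \<in> cont_funs K" for c f
    using dual_ballD(2)[OF ball that] by (auto simp: T_def)
  ultimately have "linear_isometry_C K (coded_space K) T"
    unfolding linear_isometry_C_def using T by blast
  then show ?thesis unfolding C_contains_isometric_copy_def by blast
qed

section \<open>Counting clopen sets\<close>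

lemma infinite_Times_lepoll:
  assumes "infinite A" "B \<lesssim> A" "C \<lesssim> A"
  shows "B \<times> C \<lesssim> A"
proof -
  have "A \<times> A \<approx> A"
    using card_of_Times_same_infinite[OF assms(1)] by (simp add: eqpoll_iff_card_of_ordIso)
  then show ?thesis using times_lepoll_mono[OF assms(2,3)] lepoll_trans2 by blast
qed

lemma lists_lepoll_infinite:
  assumes "infinite A"
  shows "lists A \<lesssim> A"
proof -
  have len: "{xs \<in> lists A. length xs = n} \<lesssim> A" for n
  proof (induction n)
    case 0
    have "A \<noteq> {}" using assms by auto
    then obtain a where "a \<in> A" by blast
    have "{xs \<in> lists A. length xs = 0} = {[]}" by auto
    also have "\<dots> \<lesssim> {a}" by (intro eqpoll_imp_lepoll singleton_eqpoll)
    also have "\<dots> \<lesssim> A" using \<open>a \<in> A\<close> by (intro subset_imp_lepoll) simp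
    finally show ?case .
  next
    case (Suc n)
    have "{xs \<in> lists A. length xs = Suc n} \<subseteq> (\<lambda>(x, xs). x # xs) ` (A \<times> {xs \<in> lists A. length xs = n})"
    proof
      fix ys assume "ys \<in> {xs \<in> lists A. length xs = Suc n}"
      then show "ys \<in> (\<lambda>(x, xs). x # xs) ` (A \<times> {xs \<in> lists A. length xs = n})"
        by (cases ys) auto
    qed
    then have "{xs \<in> lists A. length xs = Suc n} \<lesssim> A \<times> {xs \<in> lists A. length xs = n}"
      by (rule subset_image_lepoll)
    also have "\<dots> \<lesssim> A" by (rule infinite_Times_lepoll[OF assms lepoll_refl Suc.IH])
    finally show ?case .
  qed
  have "(card_of (\<Union>n. {xs \<in> lists A. length xs = n}), card_of A) \<in> ordLeq"
  proof (rule card_of_UNION_ordLeq_infinite[OF assms])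
    show "(card_of (UNIV :: nat set), card_of A) \<in> ordLeq"
      using assms infinite_iff_card_of_nat by blast
    show "\<forall>n\<in>UNIV. (card_of {xs \<in> lists A. length xs = n}, card_of A) \<in> ordLeq"
      using len unfolding lepoll_def card_of_ordLeq[symmetric] by blast
  qed
  moreover have "(\<Union>n. {xs \<in> lists A. length xs = n}) = lists A" by auto
  ultimately show ?thesis unfolding lepoll_def card_of_ordLeq[symmetric] by simp
qed

text \<open>Clopen sets are finite unions of cylinders, hence described by finite lists over a set of the
size of \<open>clopens K\<close>. Conversely, prescribing the first digit at \<open>U\<close> gives a clopen set,
and a point of \<open>U\<close> outside \<open>V\<close> tells the ones for \<open>U\<close> and \<open>V\<close>
apart.\<close>

lemma clopens_coded_space_eqpoll:
  assumes K: "compact_space K" "Hausdorff_space K" "totally_disconnected_space K"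
    and inf: "infinite (clopens K)"
  shows "clopens (coded_space K) \<approx> clopens K"
proof (rule lepoll_antisym)
  let ?A = "code_index K \<times> (UNIV :: bool set)"
  have "code_index K \<lesssim> clopens K"
    unfolding code_index_def
    using inf by (intro infinite_Times_lepoll lepoll_refl) (auto simp: infinite_le_lepoll)
  moreover have "(UNIV :: bool set) \<lesssim> clopens K"
    using inf by (intro finite_lepoll_infinite) auto
  ultimately have A: "?A \<lesssim> clopens K" by (rule infinite_Times_lepoll[OF inf])
  have infA: "infinite ?A"
  proof -
    have "infinite (code_index K)"
      using inf unfolding code_index_def by (auto simp: finite_cartesian_product_iff clopens_boolean_ops)
    then show ?thesis by (auto simp: finite_cartesian_product_iff)
  qed
  then have "infinite (lists ?A)"
    using lepoll_lists[of ?A] by (meson finite_lepoll_infinite infinite_le_lepoll lepoll_trans)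
  have "clopens (coded_space K) \<subseteq> (\<lambda>L. \<Union>l\<in>set L. cylinder K l) ` lists (lists ?A)"
  proof
    fix U assume "U \<in> clopens (coded_space K)"
    with K obtain L where "\<forall>l\<in>set L. set l \<subseteq> ?A" "U = (\<Union>l\<in>set L. cylinder K l)"
      by (rule clopen_coded_space_finite_union)
    then show "U \<in> (\<lambda>L. \<Union>l\<in>set L. cylinder K l) ` lists (lists ?A)"
      unfolding lists_eq_set by (intro image_eqI[of _ _ L]) auto
  qed
  then have "clopens (coded_space K) \<lesssim> lists (lists ?A)" by (rule subset_image_lepoll)
  also have "\<dots> \<lesssim> lists ?A" by (rule lists_lepoll_infinite) fact
  also have "\<dots> \<lesssim> ?A" by (rule lists_lepoll_infinite[OF infA])
  also have "\<dots> \<lesssim> clopens K" by (rule A)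
  finally show "clopens (coded_space K) \<lesssim> clopens K" .
next
  let ?c = "\<lambda>U. cylinder K [((U, 0), True)]"
  have clopen: "?c U \<in> clopens (coded_space K)" if "U \<in> clopens K" for U
  proof -
    have opn: "openin (coded_space K) (cylinder K [((U, 0), b)])" for b
      by (rule openin_cylinder) (use that in \<open>simp add: code_index_def\<close>)
    from opn[of False] have "closedin (coded_space K) (topspace (coded_space K) - cylinder K [((U, 0), False)])"
      by (simp add: closedin_diff)
    moreover have "?c U = topspace (coded_space K) - cylinder K [((U, 0), False)]"
      by (auto simp: cylinder_def topspace_coded_space)
    ultimately have "closedin (coded_space K) (?c U)" by (simp only:)
    with opn show ?thesis unfolding clopens_def by blast
  qed
  have sep: "?c U \<noteq> ?c V" if UV: "U \<in> clopens K" "V \<in> clopens K" "x \<in> U" "x \<notin> V" for U V x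
  proof -
    define \<delta> where "\<delta> = (\<lambda>f\<in>cont_funs K. f x)"
    have \<delta>: "\<delta> \<in> dual_ball K"
      unfolding \<delta>_def by (rule point_evaluation_in_dual_ball[OF K(1)])
    have val: "\<delta> (indicator W) = indicator W x" if "W \<in> clopens K" for W
      using indicator_cont_funs[OF that] by (simp add: \<delta>_def)
    \<comment> \<open>The evaluation at \<open>x\<close> takes the value 0 at \<open>V\<close>, and 0 has an expansion that begins with \<open>- 1 / 2\<close>.\<close>
    define N where "N W = (if W = V then 1 else 0 :: nat)" for W
    have "\<bar>\<delta> (indicator W) - signed_sum (\<lambda>_. False) (N W)\<bar> \<le> 1 / 2 ^ N W" if "W \<in> clopens K" for W
      using val[OF that] UV(4) by (simp add: N_def signed_sum_def indicator_def)
    from dual_ball_has_codes[OF \<delta> this]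
    obtain z where z: "(z, \<delta>) \<in> coded_ball K" "\<forall>W\<in>clopens K. \<forall>n<N W. z (W, n) = False" by blast
    have "sign_code (\<lambda>n. z (U, n)) 1"
      using z(1) val[OF UV(1)] UV(1,3) by (auto simp: coded_ball_def)
    then have "z (U, 0)" by (rule sign_code_one)
    then have "(z, \<delta>) \<in> ?c U" using z(1) by (simp add: cylinder_def)
    moreover have "(z, \<delta>) \<notin> ?c V" using z(2) UV(2) by (simp add: cylinder_def N_def)
    ultimately show ?thesis by metis
  qed
  have "inj_on ?c (clopens K)"
  proof (rule inj_onI, rule ccontr)
    fix U V assume UV: "U \<in> clopens K" "V \<in> clopens K" "?c U = ?c V" "U \<noteq> V"
    then obtain x where "x \<in> U \<and> x \<notin> V \<or> x \<in> V \<and> x \<notin> U" by blast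
    then show False using sep[OF UV(1,2)] sep[OF UV(2,1)] UV(3) by metis
  qed
  then show "clopens K \<lesssim> clopens (coded_space K)"
    unfolding lepoll_def using clopen by blast
qed

section \<open>Realising a Stone space over a given carrier\<close>

definition clopen_order :: "'a set \<Rightarrow> ('a \<Rightarrow> 'k set) \<Rightarrow> 'a gorder" where
  "clopen_order S g = \<lparr>carrier = S, eq = (=), le = (\<lambda>x y. g x \<subseteq> g y)\<rparr>"

lemma clopen_order_simps [simp]:
  "carrier (clopen_order S g) = S" "(.=\<^bsub>clopen_order S g\<^esub>) = (=)"
  "x \<sqsubseteq>\<^bsub>clopen_order S g\<^esub> y \<longleftrightarrow> g x \<subseteq> g y"
  by (simp_all add: clopen_order_def)

lemma clopen_order_boolean_alg:
  assumes g: "bij_betw g S (clopens K)"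
  shows "boolean_alg (clopen_order S g)" and "clopen_iso (clopen_order S g) K g"
proof -
  let ?B = "clopen_order S g"
  have gS: "g x \<in> clopens K" if "x \<in> S" for x using g that by (rule bij_betwE[THEN bspec])
  have inj: "x = y" if "x \<in> S" "y \<in> S" "g x = g y" for x y
    using inj_onD[OF bij_betw_imp_inj_on[OF g] that(3,1,2)] .
  have surj: "\<exists>x\<in>S. g x = U" if "U \<in> clopens K" for U
    using bij_betw_imp_surj_on[OF g] that by (metis imageE)
  interpret B: partial_order ?B
    by unfold_locales (auto intro: inj)
  have lub: "least ?B s (Upper ?B {x, y})" if "x \<in> S" "y \<in> S" "s \<in> S" "g s = g x \<union> g y" for x y s
    using that by (auto simp: least_def Upper_def)
  have glb: "greatest ?B s (Lower ?B {x, y})" if "x \<in> S" "y \<in> S" "s \<in> S" "g s = g x \<inter> g y" for x y s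
    using that by (auto simp: greatest_def Lower_def)
  obtain bot where bot: "bot \<in> S" "g bot = {}" using surj[OF clopens_boolean_ops(4)] by blast
  obtain top where top: "top \<in> S" "g top = topspace K" using surj[OF clopens_boolean_ops(5)] by blast
  interpret B: bounded_lattice ?B
  proof unfold_locales
    show "\<exists>s. least ?B s (Upper ?B {x, y})" if "x \<in> carrier ?B" "y \<in> carrier ?B" for x y
      using that surj[OF clopens_boolean_ops(1)[OF gS[of x] gS[of y]]] lub by auto
    show "\<exists>s. greatest ?B s (Lower ?B {x, y})" if "x \<in> carrier ?B" "y \<in> carrier ?B" for x y
      using that surj[OF clopens_boolean_ops(2)[OF gS[of x] gS[of y]]] glb by auto
    show "\<exists>x. least ?B x (carrier ?B)"
      using bot by (intro exI[of _ bot]) (auto simp: least_def)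
    show "\<exists>x. greatest ?B x (carrier ?B)"
      using top clopensD(3)[OF gS] by (intro exI[of _ top]) (auto simp: greatest_def)
  qed
  have join: "g (x \<squnion>\<^bsub>?B\<^esub> y) = g x \<union> g y" if xy: "x \<in> S" "y \<in> S" for x y
  proof -
    obtain s where s: "s \<in> S" "g s = g x \<union> g y"
      using surj[OF clopens_boolean_ops(1)[OF gS[OF xy(1)] gS[OF xy(2)]]] by blast
    show ?thesis
      using B.join_left[of x y] B.join_right[of x y] B.join_le[of x s y] that s by auto
  qed
  have meet: "g (x \<sqinter>\<^bsub>?B\<^esub> y) = g x \<inter> g y" if xy: "x \<in> S" "y \<in> S" for x y
  proof -
    obtain s where s: "s \<in> S" "g s = g x \<inter> g y"
      using surj[OF clopens_boolean_ops(2)[OF gS[OF xy(1)] gS[OF xy(2)]]] by blast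
    show ?thesis
      using B.meet_left[of x y] B.meet_right[of x y] B.meet_le[of s x y] that s by auto
  qed
  have bottom: "g \<bottom>\<^bsub>?B\<^esub> = {}"
    using B.bottom_lower[of bot] bot by auto
  have topp: "g \<top>\<^bsub>?B\<^esub> = topspace K"
    using B.top_higher[of top] top clopensD(3)[OF gS[of "\<top>\<^bsub>?B\<^esub>"]] B.top_closed by auto
  have closed: "x \<squnion>\<^bsub>?B\<^esub> y \<in> S" "x \<sqinter>\<^bsub>?B\<^esub> y \<in> S" if "x \<in> S" "y \<in> S" for x y
    using B.join_closed[of x y] B.meet_closed[of x y] that by auto
  show "clopen_iso ?B K g"
    unfolding clopen_iso_def using g join meet bottom topp by simp
  show "boolean_alg ?B"
  proof unfold_locales
    fix x y z assume "x \<in> carrier ?B" "y \<in> carrier ?B" "z \<in> carrier ?B"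
    then show "x \<sqinter>\<^bsub>?B\<^esub> (y \<squnion>\<^bsub>?B\<^esub> z) = (x \<sqinter>\<^bsub>?B\<^esub> y) \<squnion>\<^bsub>?B\<^esub> (x \<sqinter>\<^bsub>?B\<^esub> z)"
      by (intro inj) (auto simp: closed join meet)
  next
    fix x assume x: "x \<in> carrier ?B"
    obtain y where y: "y \<in> S" "g y = topspace K - g x"
      using surj[OF clopens_boolean_ops(3)[OF clopens_boolean_ops(5) gS]] x by auto
    have "x \<sqinter>\<^bsub>?B\<^esub> y = \<bottom>\<^bsub>?B\<^esub>"
      using x y B.bottom_closed by (intro inj) (auto simp: closed meet bottom)
    moreover have "x \<squnion>\<^bsub>?B\<^esub> y = \<top>\<^bsub>?B\<^esub>"
      using x y B.top_closed clopensD(3)[OF gS] by (intro inj) (auto simp: closed join topp)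
    ultimately show "\<exists>y\<in>carrier ?B. x \<sqinter>\<^bsub>?B\<^esub> y = \<bottom>\<^bsub>?B\<^esub> \<and> x \<squnion>\<^bsub>?B\<^esub> y = \<top>\<^bsub>?B\<^esub>"
      using y(1) by auto
  qed
qed

lemma stone_space_homeomorphic_copy:
  assumes hom: "homeomorphic_maps K K' \<phi> \<psi>" and st: "stone_space_of L K"
  shows "stone_space_of L K'"
proof -
  have hm: "homeomorphic_map K K' \<phi>" and hm': "homeomorphic_map K' K \<psi>"
    using hom by (simp_all add: homeomorphic_maps_map)
  have sp: "K homeomorphic_space K'" using hom unfolding homeomorphic_space_def by blast
  obtain h where h: "clopen_iso L K h" using st unfolding stone_space_of_def by blast
  have cont: "continuous_map K K' \<phi>" "continuous_map K' K \<psi>"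
    and inv: "\<And>x. x \<in> topspace K \<Longrightarrow> \<psi> (\<phi> x) = x" "\<And>y. y \<in> topspace K' \<Longrightarrow> \<phi> (\<psi> y) = y"
    using hom by (simp_all add: homeomorphic_maps_def)
  have img: "\<phi> ` U \<in> clopens K'" if "U \<in> clopens K" for U
    using that homeomorphic_map_openness[OF hm] homeomorphic_map_closedness[OF hm]
    unfolding clopens_def by (simp add: openin_subset)
  have img': "\<psi> ` V \<in> clopens K" if "V \<in> clopens K'" for V
    using that homeomorphic_map_openness[OF hm'] homeomorphic_map_closedness[OF hm']
    unfolding clopens_def by (simp add: openin_subset)
  have "bij_betw ((`) \<phi>) (clopens K) (clopens K')"
  proof (rule bij_betwI[where g = "(`) \<psi>"])
    show "(`) \<phi> \<in> clopens K \<rightarrow> clopens K'" using img by blast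
    show "(`) \<psi> \<in> clopens K' \<rightarrow> clopens K" using img' by blast
    show "\<psi> ` \<phi> ` U = U" if "U \<in> clopens K" for U
      unfolding image_image using image_cong[of U U "\<lambda>x. \<psi> (\<phi> x)" "\<lambda>x. x"] inv(1) clopensD(3)[OF that]
      by (simp add: subset_iff)
    show "\<phi> ` \<psi> ` V = V" if "V \<in> clopens K'" for V
      unfolding image_image using image_cong[of V V "\<lambda>x. \<phi> (\<psi> x)" "\<lambda>x. x"] inv(2) clopensD(3)[OF that]
      by (simp add: subset_iff)
  qed
  moreover have "bij_betw h (carrier L) (clopens K)" using h unfolding clopen_iso_def by blast
  ultimately have bij: "bij_betw ((`) \<phi> \<circ> h) (carrier L) (clopens K')"
    by (rule bij_betw_trans[rotated])
  have sub: "h x \<subseteq> topspace K" if "x \<in> carrier L" for x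
    using h that clopensD(3)[of "h x" K] unfolding clopen_iso_def bij_betw_def by blast
  have inj: "inj_on \<phi> (topspace K)" by (rule inj_on_inverseI) (rule inv(1))
  have "clopen_iso L K' ((`) \<phi> \<circ> h)"
    using h bij sub homeomorphic_imp_surjective_map[OF hm]
    unfolding clopen_iso_def by (simp add: image_Un inj_on_image_Int[OF inj])
  moreover have "totally_disconnected_space K'"
    unfolding totally_disconnected_space_def
  proof (intro allI impI)
    fix S assume S: "connectedin K' S"
    then have "connectedin K (\<psi> ` S)" by (rule connectedin_continuous_map_image[OF cont(2)])
    then obtain x where "\<psi> ` S \<subseteq> {x}"
      using st unfolding stone_space_of_def totally_disconnected_space_def by blast
    moreover have "S \<subseteq> topspace K'" using S by (rule connectedin_subset_topspace)
    ultimately have "S \<subseteq> {\<phi> x}" using inv(2) by fastforce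
    then show "\<exists>x. S \<subseteq> {x}" by blast
  qed
  moreover have "compact_space K'" "Hausdorff_space K'"
    using st homeomorphic_compact_space[OF sp] homeomorphic_Hausdorff_space[OF sp]
    unfolding stone_space_of_def by blast+
  ultimately show ?thesis unfolding stone_space_of_def by blast
qed

lemma isometric_copy_homeomorphic:
  assumes hom: "homeomorphic_maps K K' \<phi> \<psi>" and iso: "C_contains_isometric_copy K L"
  shows "C_contains_isometric_copy K' L"
proof -
  obtain T where T: "linear_isometry_C L K T"
    using iso unfolding C_contains_isometric_copy_def by blast
  have cont: "continuous_map K' K \<psi>" using hom unfolding homeomorphic_maps_def by blast
  have img: "\<psi> ` topspace K' = topspace K"
    using hom homeomorphic_imp_surjective_map homeomorphic_maps_map by blast
  define T' where "T' f y = (if y \<in> topspace K' then T f (\<psi> y) else 0)" for f y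
  have T'_mem: "T' f \<in> cont_funs K'" if "f \<in> cont_funs L" for f
  proof -
    have "continuous_map K euclideanreal (T f)"
      using T that unfolding linear_isometry_C_def cont_funs_def by blast
    then have "continuous_map K' euclideanreal (T f \<circ> \<psi>)" by (rule continuous_map_compose[OF cont])
    then have "continuous_map K' euclideanreal (T' f)"
      by (rule continuous_map_eq) (simp add: T'_def)
    then show ?thesis unfolding cont_funs_def by (simp add: T'_def)
  qed
  have "(\<lambda>y. \<bar>T' f y\<bar>) ` topspace K' = (\<lambda>x. \<bar>T f x\<bar>) ` topspace K" for f
    unfolding img[symmetric] image_image by (rule image_cong) (simp_all add: T'_def)
  then have "sup_norm K' (T' f) = sup_norm K (T f)" for f unfolding sup_norm_def by simp
  then have "linear_isometry_C L K' T'"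
    using T T'_mem unfolding linear_isometry_C_def by (auto simp: T'_def)
  then show ?thesis unfolding C_contains_isometric_copy_def by blast
qed

text \<open>A point can be replaced by the set of all names of clopen sets containing it, because clopen sets
separate points.\<close>

lemma stone_space_point_sets:
  fixes S :: "'a set"
  assumes K: "compact_space K" "Hausdorff_space K" "totally_disconnected_space K"
    and g: "bij_betw g S (clopens K)"
  obtains K' :: "'a set topology" and \<phi> \<psi> where "homeomorphic_maps K K' \<phi> \<psi>"
proof -
  define \<phi> where "\<phi> p = {s \<in> S. p \<in> g s}" for p
  have inj: "inj_on \<phi> (topspace K)"
  proof (rule inj_onI, rule ccontr)
    fix p q assume pq: "p \<in> topspace K" "q \<in> topspace K" "\<phi> p = \<phi> q" "p \<noteq> q"
    obtain U where U: "U \<in> clopens K" "p \<in> U" "q \<notin> U"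
      using K pq(1,2,4) by (rule clopens_separate_points)
    then obtain s where "s \<in> S" "g s = U" using bij_betw_imp_surj_on[OF g] by blast
    then show False using pq(3) U unfolding \<phi>_def by blast
  qed
  define \<psi> where "\<psi> = inv_into (topspace K) \<phi>"
  define K' where "K' = pullback_topology (\<phi> ` topspace K) \<psi> K"
  have inv: "\<psi> (\<phi> p) = p" if "p \<in> topspace K" for p
    unfolding \<psi>_def using inj that by (rule inv_into_f_f)
  have top: "topspace K' = \<phi> ` topspace K"
    unfolding K'_def topspace_pullback_topology using inv by auto
  have "continuous_map K' K (id \<circ> \<psi>)"
    unfolding K'_def by (rule continuous_map_pullback[OF continuous_map_id])
  moreover have "continuous_map K K' \<phi>"
    unfolding K'_def
  proof (rule continuous_map_pullback')
    show "continuous_map K K (\<psi> \<circ> \<phi>)"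
      by (rule continuous_map_eq[OF continuous_map_id]) (simp add: inv)
  qed auto
  ultimately have "homeomorphic_maps K K' \<phi> \<psi>"
    unfolding homeomorphic_maps_def using inv top by auto
  then show thesis by (rule that)
qed

lemma boolean_algebra_with_stone_space:
  fixes S :: "'a set"
  assumes K: "compact_space K" "Hausdorff_space K" "totally_disconnected_space K"
    and g: "bij_betw g S (clopens K)" and iso: "C_contains_isometric_copy K L"
  shows "\<exists>K_B :: 'a set topology. stone_space_of (clopen_order S g) K_B \<and> C_contains_isometric_copy K_B L"
proof -
  have "stone_space_of (clopen_order S g) K"
    unfolding stone_space_of_def using K clopen_order_boolean_alg(2)[OF g] by blast
  moreover obtain K' :: "'a set topology" and \<phi> \<psi> where "homeomorphic_maps K K' \<phi> \<psi>"
    using K g by (rule stone_space_point_sets)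
  ultimately show ?thesis
    using stone_space_homeomorphic_copy[of K K' \<phi> \<psi>] isometric_copy_homeomorphic[of K K' \<phi> \<psi>] iso
    by blast
qed

text \<open>Passing to a subchain with countable initial segments reduces this to the statement about
clopen sets.\<close>

lemma no_uncountable_well_ordered_chain:
  assumes K: "compact_space K" "Hausdorff_space K" "totally_disconnected_space K"
    and g: "bij_betw g S (clopens (coded_space K))"
    and C: "well_ordered_chain (clopen_order S g) C"
  shows "countable C"
proof (rule ccontr)
  assume unc: "uncountable C"
  have wo: "well_order_on C {(x, y). x \<in> C \<and> y \<in> C \<and> g x \<subseteq> g y}" and CS: "C \<subseteq> S"
    using C unfolding well_ordered_chain_def by simp_all
  obtain D where D: "D \<subseteq> C" "uncountable D"
      "\<forall>x\<in>D. countable {y \<in> D. (y, x) \<in> {(x, y). x \<in> C \<and> y \<in> C \<and> g x \<subseteq> g y}}"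
    using wo unc by (rule well_order_countable_initial_segments)
  have DS: "D \<subseteq> S" using D(1) CS by (rule subset_trans)
  have inj: "inj_on g D" by (rule inj_on_subset[OF bij_betw_imp_inj_on[OF g] DS])
  have "total_on C {(x, y). x \<in> C \<and> y \<in> C \<and> g x \<subseteq> g y}"
    using wo unfolding well_order_on_def linear_order_on_def by (elim conjE)
  then have total: "g x \<subseteq> g y \<or> g y \<subseteq> g x" if "x \<in> D" "y \<in> D" for x y
    using subsetD[OF D(1) that(1)] subsetD[OF D(1) that(2)]
    by (cases "x = y") (simp_all add: total_on_def)
  have "countable (g ` D)"
  proof (rule countable_coded_chain[OF K])
    show "g ` D \<subseteq> clopens (coded_space K)"
      unfolding bij_betw_imp_surj_on[OF g, symmetric] by (rule image_mono[OF DS])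
    show "c \<subseteq> d \<or> d \<subseteq> c" if "c \<in> g ` D" "d \<in> g ` D" for c d
      using that total by (elim imageE) simp
    show "countable {d \<in> g ` D. d \<subseteq> c}" if c: "c \<in> g ` D" for c
    proof -
      obtain x where x: "x \<in> D" "c = g x" using c by blast
      have "{d \<in> g ` D. d \<subseteq> c} \<subseteq> g ` {y \<in> D. (y, x) \<in> {(x, y). x \<in> C \<and> y \<in> C \<and> g x \<subseteq> g y}}"
        using x D(1) by blast
      moreover have "countable (g ` {y \<in> D. (y, x) \<in> {(x, y). x \<in> C \<and> y \<in> C \<and> g x \<subseteq> g y}})"
        by (rule countable_image) (rule bspec[OF D(3) x(1)])
      ultimately show ?thesis by (rule countable_subset)
    qed
  qed
  then have "countable D" using inj by (rule countable_image_inj_on)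
  then show False using D(2) by simp
qed

theorem proposition3p5:
  fixes A :: "'a gorder" and K_A :: "'k topology"
  assumes "boolean_alg A" and "stone_space_of A K_A"
  shows "\<exists>(B :: 'a gorder) (K_B :: 'a set topology).
           boolean_alg B \<and> stone_space_of B K_B \<and>
           carrier B \<approx> carrier A \<and>
           \<not> (\<exists>C. uncountable C \<and> well_ordered_chain B C) \<and>
           C_contains_isometric_copy K_B K_A"
proof -
  have K: "compact_space K_A" "Hausdorff_space K_A" "totally_disconnected_space K_A"
    using assms(2) unfolding stone_space_of_def by blast+
  obtain h where h: "bij_betw h (carrier A) (clopens K_A)"
    using assms(2) unfolding stone_space_of_def clopen_iso_def by blast
  show ?thesis
  proof (cases "finite (carrier A)")
    case True
    \<comment> \<open>A finite algebra has no infinite chains, and the coded ball would have too many clopen sets.\<close>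
    have "linear_isometry_C K_A K_A (\<lambda>f. f)" by (simp add: linear_isometry_C_def)
    then have "C_contains_isometric_copy K_A K_A" unfolding C_contains_isometric_copy_def by blast
    from boolean_algebra_with_stone_space[OF K h this]
    obtain K_B :: "'a set topology" where "stone_space_of (clopen_order (carrier A) h) K_B"
      "C_contains_isometric_copy K_B K_A" by blast
    moreover have "countable C" if "well_ordered_chain (clopen_order (carrier A) h) C" for C
      using that True unfolding well_ordered_chain_def by (auto intro: countable_finite finite_subset)
    moreover have "carrier (clopen_order (carrier A) h) \<approx> carrier A" by simp
    ultimately show ?thesis using clopen_order_boolean_alg(1)[OF h] by blast
  next
    case False
    have Q: "compact_space (coded_space K_A)" "Hausdorff_space (coded_space K_A)"
        "totally_disconnected_space (coded_space K_A)"
      by (rule compact_coded_space Hausdorff_coded_space totally_disconnected_coded_space[OF K])+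
    have "infinite (clopens K_A)" using False bij_betw_finite[OF h] by simp
    then have "clopens (coded_space K_A) \<approx> clopens K_A" by (rule clopens_coded_space_eqpoll[OF K])
    also have "clopens K_A \<approx> carrier A" using h by (metis eqpoll_def eqpoll_sym)
    finally have "carrier A \<approx> clopens (coded_space K_A)" by (rule eqpoll_sym)
    then obtain g where g: "bij_betw g (carrier A) (clopens (coded_space K_A))"
      unfolding eqpoll_def by blast
    from boolean_algebra_with_stone_space[OF Q g C_coded_space_contains_isometric_copy[OF K(1)]]
    obtain K_B :: "'a set topology" where "stone_space_of (clopen_order (carrier A) g) K_B"
      "C_contains_isometric_copy K_B K_A" by blast
    moreover have "countable C" if "well_ordered_chain (clopen_order (carrier A) g) C" for C
      using K g that by (rule no_uncountable_well_ordered_chain)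
    moreover have "carrier (clopen_order (carrier A) g) \<approx> carrier A" by simp
    ultimately show ?thesis using clopen_order_boolean_alg(1)[OF g] by blast
  qed
qed

end
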